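(* Let $\varphi : M^m \to N^{m+1}(c)$ be a biconservative hypersurface in a space form with $c \leq 0$. If $M$ has non-negative sectional curvature, then $M$ is CMC, i.e. its mean curvature function $f$ is constant.
   Context: All manifolds are connected, oriented and of dimension at least $2$. $N^{m+1}(c)$ denotes an $(m+1)$-dimensional space form of constant sectional curvature $c$. A hypersurface $\varphi : M^m \to N^{m+1}(c)$ is an isometric immersion of an $m$-dimensional Riemannian manifold $M$ ($M$ is not assumed compact). With $\eta$ a unit section of the normal bundle, $A = A_\eta$ is the shape operator and $f = (\operatorname{trace} A)/m$ is the mean curvature function. The hypersurface is biconservative if the tangent part of its bitension field vanishes, equivalently $$A(\operatorname{grad} f) = -\frac{m}{2} f \operatorname{grad} f \quad \text{on } M.$$ *)

theory Defs
  imports "HOL-Analysis.Analysis"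
begin

subsection \<open>Smooth maps between vector spaces\<close>

abbreviation fderiv ::
    "('a::real_normed_vector \<Rightarrow> 'b::real_normed_vector) \<Rightarrow> 'a \<Rightarrow> 'a \<Rightarrow> 'b" where
  "fderiv f x v \<equiv> frechet_derivative f (at x) v"

text \<open>Meant for open \<open>S\<close> in a finite-dimensional space; the derivatives are taken in the ambient
  space.\<close>

primrec Ck_on ::
    "nat \<Rightarrow> 'a::euclidean_space set \<Rightarrow> ('a \<Rightarrow> 'b::real_normed_vector) \<Rightarrow> bool" where
  "Ck_on 0 S f \<longleftrightarrow> continuous_on S f"
| "Ck_on (Suc k) S f \<longleftrightarrow>
     (\<forall>x\<in>S. f differentiable (at x)) \<and> (\<forall>v. Ck_on k S (\<lambda>x. fderiv f x v))"

definition smooth_on :: "'a::euclidean_space set \<Rightarrow> ('a \<Rightarrow> 'b::real_normed_vector) \<Rightarrow> bool" where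
  "smooth_on S f \<longleftrightarrow> (\<forall>k. Ck_on k S f)"


subsection \<open>Oriented smooth manifolds\<close>

datatype ('a, 'e) chart = Chart (cdom: "'a set") (cmap: "'a \<Rightarrow> 'e")

definition cinv :: "('a, 'e) chart \<Rightarrow> 'e \<Rightarrow> 'a" where
  "cinv c = inv_into (cdom c) (cmap c)"

text \<open>The map \<open>\<phi>\<close> read in a chart \<open>c\<close> of the source and a chart \<open>d\<close> of the target. With
  \<open>\<phi> = id\<close> this is the transition map from \<open>c\<close> to \<open>d\<close>.\<close>

definition chart_rep ::
    "('a, 'e) chart \<Rightarrow> ('b, 'f) chart \<Rightarrow> ('a \<Rightarrow> 'b) \<Rightarrow> 'e \<Rightarrow> 'f" where
  "chart_rep c d \<phi> = cmap d \<circ> \<phi> \<circ> cinv c"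

definition carrier :: "('a, 'e) chart set \<Rightarrow> 'a set" where
  "carrier A = (\<Union>c\<in>A. cdom c)"

text \<open>The Hausdorff and second countability axioms are carried by the type classes.\<close>

definition oriented_manifold ::
    "('a::{t2_space,second_countable_topology}, real^'m) chart set \<Rightarrow> bool" where
  "oriented_manifold A \<longleftrightarrow>
     (\<forall>c\<in>A. open (cdom c) \<and> open (cmap c ` cdom c)
        \<and> homeomorphism (cdom c) (cmap c ` cdom c) (cmap c) (cinv c))
   \<and> (\<forall>c\<in>A. \<forall>d\<in>A. smooth_on (cmap c ` (cdom c \<inter> cdom d)) (chart_rep c d id))
   \<and> (\<forall>c\<in>A. \<forall>d\<in>A. \<forall>p \<in> cdom c \<inter> cdom d.
        det (matrix (fderiv (chart_rep c d id) (cmap c p))) > 0)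
   \<and> connected (carrier A)"

definition smooth_map ::
    "('a::topological_space, real^'m) chart set \<Rightarrow> ('b::topological_space, real^'n) chart set
      \<Rightarrow> ('a \<Rightarrow> 'b) \<Rightarrow> bool" where
  "smooth_map A B \<phi> \<longleftrightarrow>
     continuous_on (carrier A) \<phi> \<and> \<phi> ` carrier A \<subseteq> carrier B
   \<and> (\<forall>c\<in>A. \<forall>d\<in>B. smooth_on (cmap c ` (cdom c \<inter> \<phi> -` cdom d)) (chart_rep c d \<phi>))"


subsection \<open>Riemannian geometry in a chart domain\<close>

text \<open>A metric on an open subset of a vector space is a function \<open>G\<close>, where \<open>G x\<close> is the inner
  product at the point \<open>x\<close>.\<close>

type_synonym 'e metric = "'e \<Rightarrow> 'e \<Rightarrow> 'e \<Rightarrow> real"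

text \<open>The vector representing a linear form with respect to an inner product.\<close>

definition sharp :: "('e \<Rightarrow> 'e \<Rightarrow> real) \<Rightarrow> ('e \<Rightarrow> real) \<Rightarrow> 'e" where
  "sharp b \<alpha> = (THE w. \<forall>z. b w z = \<alpha> z)"

text \<open>The trace \<open>\<Sum> b\<^sup>i\<^sup>j B(e\<^sub>i, e\<^sub>j)\<close> of a vector-valued bilinear map.\<close>

definition metric_trace ::
    "(real^'m \<Rightarrow> real^'m \<Rightarrow> real) \<Rightarrow> (real^'m \<Rightarrow> real^'m \<Rightarrow> 'v::real_vector) \<Rightarrow> 'v" where
  "metric_trace b B =
     (\<Sum>i\<in>UNIV. \<Sum>j\<in>UNIV.
        matrix_inv (\<chi> k l. b (axis k 1) (axis l 1)) $ i $ j *\<^sub>R B (axis i 1) (axis j 1))"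

text \<open>\<open>christoffel G x u v\<close> is the Levi-Civita derivative at \<open>x\<close> of the constant field \<open>v\<close> in
  direction \<open>u\<close>, given by the Koszul formula; its components are \<open>\<Gamma>\<^sup>k\<^sub>i\<^sub>j u\<^sup>i v\<^sup>j\<close>.\<close>

definition christoffel :: "(real^'m) metric \<Rightarrow> real^'m \<Rightarrow> real^'m \<Rightarrow> real^'m \<Rightarrow> real^'m" where
  "christoffel G x u v = sharp (G x) (\<lambda>z.
     (fderiv (\<lambda>y. G y v z) x u + fderiv (\<lambda>y. G y u z) x v - fderiv (\<lambda>y. G y u v) x z) / 2)"

text \<open>\<open>R(u, v) w = \<nabla>\<^sub>u \<nabla>\<^sub>v w - \<nabla>\<^sub>v \<nabla>\<^sub>u w - \<nabla>\<^bsub>[u, v]\<^esub> w\<close>, evaluated on constant fields, whose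
  brackets vanish.\<close>

definition curvature ::
    "(real^'m) metric \<Rightarrow> real^'m \<Rightarrow> real^'m \<Rightarrow> real^'m \<Rightarrow> real^'m \<Rightarrow> real^'m" where
  "curvature G x u v w =
     fderiv (\<lambda>y. christoffel G y v w) x u + christoffel G x u (christoffel G x v w)
   - fderiv (\<lambda>y. christoffel G y u w) x v - christoffel G x v (christoffel G x u w)"

definition sectional_curvature ::
    "(real^'m) metric \<Rightarrow> real^'m \<Rightarrow> real^'m \<Rightarrow> real^'m \<Rightarrow> real" where
  "sectional_curvature G x u v =
     G x (curvature G x u v v) u / (G x u u * G x v v - (G x u v)\<^sup>2)"


subsection \<open>Riemannian manifolds and space forms\<close>

text \<open>A tensor field on a manifold is the family of its expressions in the charts, subject to the
  transformation law. For the metric the law is that every transition map is isometric.\<close>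

definition oriented_riemannian_manifold ::
    "('a::{t2_space,second_countable_topology}, real^'m) chart set
      \<Rightarrow> (('a, real^'m) chart \<Rightarrow> (real^'m) metric) \<Rightarrow> bool" where
  "oriented_riemannian_manifold A g \<longleftrightarrow>
     oriented_manifold A
   \<and> (\<forall>c\<in>A. \<forall>u v. smooth_on (cmap c ` cdom c) (\<lambda>x. g c x u v))
   \<and> (\<forall>c\<in>A. \<forall>x \<in> cmap c ` cdom c. bilinear (g c x)
        \<and> (\<forall>u v. g c x u v = g c x v u) \<and> (\<forall>u. u \<noteq> 0 \<longrightarrow> g c x u u > 0))
   \<and> (\<forall>c\<in>A. \<forall>d\<in>A. \<forall>x \<in> cmap c ` (cdom c \<inter> cdom d). \<forall>u v.
        g c x u v = g d (chart_rep c d id x)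
          (fderiv (chart_rep c d id) x u) (fderiv (chart_rep c d id) x v))"

definition nonneg_sectional_curvature ::
    "('a, real^'m) chart set \<Rightarrow> (('a, real^'m) chart \<Rightarrow> (real^'m) metric) \<Rightarrow> bool" where
  "nonneg_sectional_curvature A g \<longleftrightarrow>
     (\<forall>c\<in>A. \<forall>x \<in> cmap c ` cdom c. \<forall>u v. u \<noteq> v \<and> independent {u, v} \<longrightarrow>
        sectional_curvature (g c) x u v \<ge> 0)"

definition constant_sectional_curvature ::
    "('a, real^'m) chart set \<Rightarrow> (('a, real^'m) chart \<Rightarrow> (real^'m) metric) \<Rightarrow> real \<Rightarrow> bool" where
  "constant_sectional_curvature A g k \<longleftrightarrow>
     (\<forall>c\<in>A. \<forall>x \<in> cmap c ` cdom c. \<forall>u v. u \<noteq> v \<and> independent {u, v} \<longrightarrow>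
        sectional_curvature (g c) x u v = k)"

definition complete_geodesic ::
    "('a::topological_space, real^'m) chart set
      \<Rightarrow> (('a, real^'m) chart \<Rightarrow> (real^'m) metric) \<Rightarrow> (real \<Rightarrow> 'a) \<Rightarrow> bool" where
  "complete_geodesic A g \<gamma> \<longleftrightarrow>
     continuous_on UNIV \<gamma> \<and> range \<gamma> \<subseteq> carrier A
   \<and> (\<forall>c\<in>A. \<forall>t. \<gamma> t \<in> cdom c \<longrightarrow>
        (let x = cmap c \<circ> \<gamma>; x' = (\<lambda>s. vector_derivative x (at s))
         in x differentiable (at t)
          \<and> (x' has_vector_derivative - christoffel (g c) (x t) (x' t) (x' t)) (at t)))"

definition geodesically_complete ::
    "('a::topological_space, real^'m) chart set
      \<Rightarrow> (('a, real^'m) chart \<Rightarrow> (real^'m) metric) \<Rightarrow> bool" where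
  "geodesically_complete A g \<longleftrightarrow>
     (\<forall>c\<in>A. \<forall>p\<in>cdom c. \<forall>v. \<exists>\<gamma>. complete_geodesic A g \<gamma>
        \<and> \<gamma> 0 = p \<and> vector_derivative (cmap c \<circ> \<gamma>) (at 0) = v)"

definition space_form ::
    "('a::{t2_space,second_countable_topology}, real^'m) chart set
      \<Rightarrow> (('a, real^'m) chart \<Rightarrow> (real^'m) metric) \<Rightarrow> real \<Rightarrow> bool" where
  "space_form A g k \<longleftrightarrow>
     oriented_riemannian_manifold A g \<and> geodesically_complete A g
   \<and> constant_sectional_curvature A g k"


subsection \<open>Local geometry of an isometric immersion\<close>

text \<open>Here \<open>F\<close> is a local representation of the immersion, \<open>G\<close> and \<open>H\<close> are the metrics of the
  source and the target, and a vector field \<open>V\<close> along \<open>F\<close> is a function of the source point.\<close>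

definition cov_deriv ::
    "(real^'n) metric \<Rightarrow> (real^'m \<Rightarrow> real^'n) \<Rightarrow> (real^'m \<Rightarrow> real^'n)
      \<Rightarrow> real^'m \<Rightarrow> real^'m \<Rightarrow> real^'n" where
  "cov_deriv H F V x u = fderiv V x u + christoffel H (F x) (fderiv F x u) (V x)"

text \<open>\<open>(\<nabla>\<^sup>2 V)(u, v) = \<nabla>\<^sub>u \<nabla>\<^sub>v V - \<nabla>\<^bsub>\<nabla>\<^sub>u v\<^esub> V\<close>, with \<open>v\<close> extended to a constant field.\<close>

definition cov_deriv2 ::
    "(real^'m) metric \<Rightarrow> (real^'n) metric \<Rightarrow> (real^'m \<Rightarrow> real^'n) \<Rightarrow> (real^'m \<Rightarrow> real^'n)
      \<Rightarrow> real^'m \<Rightarrow> real^'m \<Rightarrow> real^'m \<Rightarrow> real^'n" where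
  "cov_deriv2 G H F V x u v =
     cov_deriv H F (\<lambda>y. cov_deriv H F V y v) x u - cov_deriv H F V x (christoffel G x u v)"

text \<open>The second fundamental form \<open>\<nabla>dF\<close> of the map.\<close>

definition hessian_map ::
    "(real^'m) metric \<Rightarrow> (real^'n) metric \<Rightarrow> (real^'m \<Rightarrow> real^'n)
      \<Rightarrow> real^'m \<Rightarrow> real^'m \<Rightarrow> real^'m \<Rightarrow> real^'n" where
  "hessian_map G H F x u v =
     cov_deriv H F (\<lambda>y. fderiv F y v) x u - fderiv F x (christoffel G x u v)"

definition tension ::
    "(real^'m) metric \<Rightarrow> (real^'n) metric \<Rightarrow> (real^'m \<Rightarrow> real^'n) \<Rightarrow> real^'m \<Rightarrow> real^'n" where
  "tension G H F x = metric_trace (G x) (hessian_map G H F x)"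

text \<open>\<open>\<tau>\<^sub>2 = - \<Delta>\<tau> - trace R(dF, \<tau>) dF\<close>, where \<open>\<Delta> = - trace \<nabla>\<^sup>2\<close> is the rough Laplacian on fields
  along \<open>F\<close>.\<close>

definition bitension ::
    "(real^'m) metric \<Rightarrow> (real^'n) metric \<Rightarrow> (real^'m \<Rightarrow> real^'n) \<Rightarrow> real^'m \<Rightarrow> real^'n" where
  "bitension G H F x =
     metric_trace (G x) (cov_deriv2 G H F (tension G H F) x)
   - metric_trace (G x) (\<lambda>u v.
       curvature H (F x) (fderiv F x u) (tension G H F x) (fderiv F x v))"

text \<open>The source vector whose image under \<open>dF\<close> is the tangent part (orthogonal projection onto the
  image of \<open>dF\<close>) of \<open>V\<close>, where \<open>F\<close> is isometric.\<close>

definition tangent_part ::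
    "(real^'m) metric \<Rightarrow> (real^'n) metric \<Rightarrow> (real^'m \<Rightarrow> real^'n) \<Rightarrow> real^'m \<Rightarrow> real^'n
      \<Rightarrow> real^'m" where
  "tangent_part G H F x V = sharp (G x) (\<lambda>w. H (F x) V (fderiv F x w))"

text \<open>\<open>dF (A u) = - (\<nabla>\<^sub>u \<eta>)\<^sup>\<top>\<close>.\<close>

definition shape_operator ::
    "(real^'m) metric \<Rightarrow> (real^'n) metric \<Rightarrow> (real^'m \<Rightarrow> real^'n) \<Rightarrow> (real^'m \<Rightarrow> real^'n)
      \<Rightarrow> real^'m \<Rightarrow> real^'m \<Rightarrow> real^'m" where
  "shape_operator G H F \<eta> x u = - tangent_part G H F x (cov_deriv H F \<eta> x u)"


subsection \<open>Hypersurfaces\<close>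

definition isometric_immersion ::
    "('a::topological_space, real^'m) chart set \<Rightarrow> (('a, real^'m) chart \<Rightarrow> (real^'m) metric)
      \<Rightarrow> ('b::topological_space, real^'n) chart set \<Rightarrow> (('b, real^'n) chart \<Rightarrow> (real^'n) metric)
      \<Rightarrow> ('a \<Rightarrow> 'b) \<Rightarrow> bool" where
  "isometric_immersion A g B h \<phi> \<longleftrightarrow>
     smooth_map A B \<phi>
   \<and> (\<forall>c\<in>A. \<forall>d\<in>B. \<forall>x \<in> cmap c ` (cdom c \<inter> \<phi> -` cdom d).
        inj (fderiv (chart_rep c d \<phi>) x)
      \<and> (\<forall>u v. g c x u v = h d (chart_rep c d \<phi> x)
           (fderiv (chart_rep c d \<phi>) x u) (fderiv (chart_rep c d \<phi>) x v)))"

text \<open>\<open>\<eta> d p\<close> is the expression in the target chart \<open>d\<close> of the normal vector at the source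
  point \<open>p\<close>.\<close>

definition unit_normal_field ::
    "('a::topological_space, real^'m) chart set
      \<Rightarrow> ('b::topological_space, real^'n) chart set \<Rightarrow> (('b, real^'n) chart \<Rightarrow> (real^'n) metric)
      \<Rightarrow> ('a \<Rightarrow> 'b) \<Rightarrow> (('b, real^'n) chart \<Rightarrow> 'a \<Rightarrow> real^'n) \<Rightarrow> bool" where
  "unit_normal_field A B h \<phi> \<eta> \<longleftrightarrow>
     (\<forall>d\<in>B. \<forall>d'\<in>B. \<forall>p \<in> carrier A. \<phi> p \<in> cdom d \<inter> cdom d' \<longrightarrow>
        \<eta> d' p = fderiv (chart_rep d d' id) (cmap d (\<phi> p)) (\<eta> d p))
   \<and> (\<forall>c\<in>A. \<forall>d\<in>B. smooth_on (cmap c ` (cdom c \<inter> \<phi> -` cdom d)) (\<eta> d \<circ> cinv c))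
   \<and> (\<forall>c\<in>A. \<forall>d\<in>B. \<forall>p \<in> cdom c \<inter> \<phi> -` cdom d.
        h d (cmap d (\<phi> p)) (\<eta> d p) (\<eta> d p) = 1
      \<and> (\<forall>u. h d (cmap d (\<phi> p)) (\<eta> d p) (fderiv (chart_rep c d \<phi>) (cmap c p) u) = 0))"

definition biconservative ::
    "('a, real^'m) chart set \<Rightarrow> (('a, real^'m) chart \<Rightarrow> (real^'m) metric)
      \<Rightarrow> ('b, real^'n) chart set \<Rightarrow> (('b, real^'n) chart \<Rightarrow> (real^'n) metric)
      \<Rightarrow> ('a \<Rightarrow> 'b) \<Rightarrow> bool" where
  "biconservative A g B h \<phi> \<longleftrightarrow>
     (\<forall>c\<in>A. \<forall>d\<in>B. \<forall>x \<in> cmap c ` (cdom c \<inter> \<phi> -` cdom d).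
        tangent_part (g c) (h d) (chart_rep c d \<phi>) x
          (bitension (g c) (h d) (chart_rep c d \<phi>) x) = 0)"

text \<open>The trace of the shape operator at \<open>p\<close> does not depend on the charts used to compute it.\<close>

definition chart_at :: "('a, 'e) chart set \<Rightarrow> 'a \<Rightarrow> ('a, 'e) chart" where
  "chart_at A p = (SOME c. c \<in> A \<and> p \<in> cdom c)"

definition mean_curvature ::
    "('a, real^'m) chart set \<Rightarrow> (('a, real^'m) chart \<Rightarrow> (real^'m) metric)
      \<Rightarrow> ('b, real^'n) chart set \<Rightarrow> (('b, real^'n) chart \<Rightarrow> (real^'n) metric)
      \<Rightarrow> ('a \<Rightarrow> 'b) \<Rightarrow> (('b, real^'n) chart \<Rightarrow> 'a \<Rightarrow> real^'n) \<Rightarrow> 'a \<Rightarrow> real" where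
  "mean_curvature A g B h \<phi> \<eta> p =
     (let c = chart_at A p; d = chart_at B (\<phi> p)
      in trace (matrix (shape_operator (g c) (h d) (chart_rep c d \<phi>) (\<eta> d \<circ> cinv c) (cmap c p)))
           / real CARD('m))"

end

theory Submission
  imports Defs
begin

text \<open>
  Write \<open>\<phi> = trace A\<close>. By the Codazzi equation the divergence of \<open>A\<close> is the gradient of
  \<open>\<phi>\<close>, so the tangent part of the bitension field \<open>\<tau>\<^sub>2\<close> of \<open>\<tau> = \<phi> \<eta>\<close> vanishes iff
  \<open>2 A \<xi> = - \<phi> \<xi>\<close> for \<open>\<xi> = grad \<phi>\<close>. Summing the sectional curvatures
  \<open>K(\<xi>, e\<^sub>i)\<close>, given by the Gauss equation, over an orthonormal basis yields
  \<open>0 \<le> c (m - 1) |\<xi>|\<^sup>2 - 3/4 \<phi>\<^sup>2 |\<xi>|\<^sup>2\<close>, and hence \<open>\<phi> \<xi> = 0\<close> because \<open>c \<le> 0\<close>. So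
  \<open>\<phi>\<^sup>2\<close> is locally constant, and then so is \<open>\<phi>\<close>.
\<close>

subsection \<open>Calculus of smooth functions\<close>

text \<open>The coefficient 3/4 is 1/2 + 1/4. The gradient \<open>\<xi>\<close> is an eigenvector of
  \<open>A\<close> for the eigenvalue \<open>- \<phi> / 2\<close>; hence in the Ricci curvature
  obtained from the Gauss equation the term \<open>G x (A x \<xi>) \<xi> * \<phi> x\<close>
  contributes -1/2 and the term \<open>- G x (A x \<xi>) (A x \<xi>)\<close> contributes -1/4 of
  \<open>(\<phi> x)^2 * G x \<xi> \<xi>\<close>. Both have the sign of \<open>c\<close>, so the
  estimate is algebra at a single point, and only the last step, by connectedness, is global. Two
  obstacles shape the development. The curvature of the target is given only through sectional
  curvatures of independent pairs, so the full tensor, which the Codazzi and Gauss equations use,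
  must be recovered by polarization. And the mean curvature is computed in charts selected anew at
  each point, so the trace of \<open>A\<close> must be shown invariant under changes of both charts
  before its constancy in one chart can be used. Local computations use constant vector fields;
  their Christoffel terms assemble into tensors.\<close>

lemma fderiv_eq: "(f has_derivative f') (at x) \<Longrightarrow> fderiv f x v = f' v"
  using frechet_derivative_at by metis

lemma fderiv_works: "f differentiable (at x) \<Longrightarrow> (f has_derivative fderiv f x) (at x)"
  by (simp add: frechet_derivative_works[symmetric])

lemma linear_fderiv: "f differentiable (at x) \<Longrightarrow> linear (fderiv f x)"
  by (rule linear_frechet_derivative)

text \<open>\<open>frechet_derivative\<close> is a choice among all derivatives at \<open>x\<close>.
  Both functions have the same set of derivatives there, so the choices agree, even at a point of
  non-differentiability.\<close>

lemma fderiv_cong_open: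
  assumes "open S" "x \<in> S" "\<And>y. y \<in> S \<Longrightarrow> f y = g y"
  shows "fderiv f x v = fderiv g x v"
proof -
  have "(f has_derivative f') (at x) \<longleftrightarrow> (g has_derivative f') (at x)" for f'
    using assms has_derivative_transform_within_open by metis
  then show ?thesis by (simp add: frechet_derivative_def)
qed

lemma differentiable_cong_open:
  assumes "open S" "x \<in> S" "\<And>y. y \<in> S \<Longrightarrow> f y = g y" "f differentiable (at x)"
  shows "g differentiable (at x)"
  using assms has_derivative_transform_within_open unfolding differentiable_def by metis

lemma Ck_on_cong:
  assumes "open S"
  shows "(\<And>x. x \<in> S \<Longrightarrow> f x = g x) \<Longrightarrow> Ck_on k S f \<Longrightarrow> Ck_on k S g"
proof (induction k arbitrary: f g)
  case 0
  then show ?case by (metis Ck_on.simps(1) continuous_on_cong)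
next
  case (Suc k)
  have "g differentiable (at x)" if "x \<in> S" for x
    using differentiable_cong_open[OF assms that Suc.prems(1)] Suc.prems(2) that by auto
  moreover have "Ck_on k S (\<lambda>x. fderiv g x v)" for v
    using Suc.IH[of "\<lambda>x. fderiv f x v" "\<lambda>x. fderiv g x v"]
      fderiv_cong_open[OF assms _ Suc.prems(1)] Suc.prems(2) by auto
  ultimately show ?case by simp
qed

lemma Ck_on_SucD: "Ck_on (Suc k) S f \<Longrightarrow> Ck_on k S f"
proof (induction k arbitrary: f)
  case 0
  then show ?case
    by (auto simp: continuous_on_eq_continuous_within
        intro!: differentiable_imp_continuous_within differentiable_at_imp_differentiable_on
        intro: differentiable_at_withinI)
next
  case (Suc k)
  then show ?case by (metis Ck_on.simps(2))
qed

lemma Ck_on_const: "Ck_on k S (\<lambda>x. a)"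
  by (induction k arbitrary: a) auto

lemma Ck_on_subset: "Ck_on k S f \<Longrightarrow> T \<subseteq> S \<Longrightarrow> Ck_on k T f"
proof (induction k arbitrary: f)
  case 0
  then show ?case by (auto intro: continuous_on_subset)
next
  case (Suc k)
  then show ?case by (meson Ck_on.simps(2) subset_iff)
qed

lemma Ck_on_add:
  assumes "open S"
  shows "Ck_on k S f \<Longrightarrow> Ck_on k S g \<Longrightarrow> Ck_on k S (\<lambda>x. f x + g x)"
proof (induction k arbitrary: f g)
  case 0
  then show ?case by (simp add: continuous_on_add)
next
  case (Suc k)
  have "fderiv f x v + fderiv g x v = fderiv (\<lambda>x. f x + g x) x v" if "x \<in> S" for x v
    using fderiv_eq[OF has_derivative_add[OF fderiv_works[of f] fderiv_works[of g]], of x v]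
      Suc.prems that by simp
  then have "Ck_on k S (\<lambda>x. fderiv (\<lambda>x. f x + g x) x v)" for v
    using Ck_on_cong[OF assms, of "\<lambda>x. fderiv f x v + fderiv g x v"] Suc by auto
  with Suc.prems show ?case by auto
qed

lemma Ck_on_scaleR:
  assumes "open S"
  shows "Ck_on k S f \<Longrightarrow> Ck_on k S g \<Longrightarrow> Ck_on k S (\<lambda>x. f x *\<^sub>R g x)"
proof (induction k arbitrary: f g)
  case 0
  then show ?case by (simp add: continuous_on_scaleR)
next
  case (Suc k)
  have "f x *\<^sub>R fderiv g x v + fderiv f x v *\<^sub>R g x = fderiv (\<lambda>x. f x *\<^sub>R g x) x v"
    if "x \<in> S" for x v
    using fderiv_eq[OF has_derivative_scaleR[OF fderiv_works[of f] fderiv_works[of g]], of x v]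
      Suc.prems that by simp
  moreover have "Ck_on k S (\<lambda>x. f x *\<^sub>R fderiv g x v + fderiv f x v *\<^sub>R g x)" for v
  proof (rule Ck_on_add[OF assms])
    show "Ck_on k S (\<lambda>x. f x *\<^sub>R fderiv g x v)"
      by (rule Suc.IH[OF Ck_on_SucD[OF Suc.prems(1)]]) (use Suc.prems in simp)
    show "Ck_on k S (\<lambda>x. fderiv f x v *\<^sub>R g x)"
      by (rule Suc.IH[OF _ Ck_on_SucD[OF Suc.prems(2)]]) (use Suc.prems in simp)
  qed
  ultimately have "Ck_on k S (\<lambda>x. fderiv (\<lambda>x. f x *\<^sub>R g x) x v)" for v
    by - (rule Ck_on_cong[OF assms])
  with Suc.prems show ?case by auto
qed

lemma Ck_on_bounded_linear:
  assumes "open S" "bounded_linear L"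
  shows "Ck_on k S f \<Longrightarrow> Ck_on k S (\<lambda>x. L (f x))"
proof (induction k arbitrary: f)
  case 0
  then show ?case using bounded_linear.continuous_on[OF assms(2)] by auto
next
  case (Suc k)
  have D: "((\<lambda>x. L (f x)) has_derivative (\<lambda>v. L (fderiv f x v))) (at x)" if "x \<in> S" for x
    using bounded_linear.has_derivative[OF assms(2) fderiv_works] Suc.prems that by auto
  then have "L (fderiv f x v) = fderiv (\<lambda>x. L (f x)) x v" if "x \<in> S" for x v
    using fderiv_eq that by metis
  then have "Ck_on k S (\<lambda>x. fderiv (\<lambda>x. L (f x)) x v)" for v
    using Ck_on_cong[OF assms(1), of "\<lambda>x. L (fderiv f x v)"] Suc by auto
  with D show ?case by (auto intro: differentiableI)
qed

lemma Ck_on_sum: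
  assumes "open S" "\<And>i. i \<in> I \<Longrightarrow> Ck_on k S (f i)"
  shows "Ck_on k S (\<lambda>x. \<Sum>i\<in>I. f i x)"
  using assms(2)
  by (induction I rule: infinite_finite_induct) (auto intro: Ck_on_const Ck_on_add assms(1))

lemma fderiv_compose:
  fixes g :: "'a::real_normed_vector \<Rightarrow> 'b::euclidean_space"
  assumes "g differentiable (at x)" "f differentiable (at (g x))"
  shows "fderiv (\<lambda>x. f (g x)) x v = fderiv f (g x) (fderiv g x v)"
  using fderiv_eq[OF diff_chain_at[OF fderiv_works fderiv_works, OF assms]]
  by (simp add: comp_def)

lemma linear_euclidean_sum:
  fixes f :: "'a::euclidean_space \<Rightarrow> 'b::real_vector"
  assumes "linear f"
  shows "f v = (\<Sum>b\<in>Basis. (v \<bullet> b) *\<^sub>R f b)"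
proof -
  have "f v = f (\<Sum>b\<in>Basis. (v \<bullet> b) *\<^sub>R b)"
    by (simp add: euclidean_representation)
  then show ?thesis
    by (simp add: linear_sum[OF assms] linear_scale[OF assms])
qed

text \<open>In the chain rule the derivative of \<open>f\<close> is taken in the direction
  \<open>fderiv g x v\<close>, which moves with \<open>x\<close>, while \<open>Ck_on\<close> speaks
  of fixed directions. Expanding that direction in \<open>Basis\<close> leaves a finite sum of
  products to which the induction hypothesis applies.\<close>

lemma Ck_on_compose:
  fixes f :: "'b::euclidean_space \<Rightarrow> 'c::real_normed_vector"
  assumes "open S" "\<And>x. x \<in> S \<Longrightarrow> g x \<in> T"
  shows "Ck_on k T f \<Longrightarrow> Ck_on k S g \<Longrightarrow> Ck_on k S (\<lambda>x. f (g x))"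
proof (induction k arbitrary: f)
  case 0
  then show ?case using assms(2)
    by (auto intro: continuous_on_compose2)
next
  case (Suc k)
  have eq: "(\<Sum>b\<in>Basis. (fderiv g x v \<bullet> b) *\<^sub>R fderiv f (g x) b) = fderiv (\<lambda>x. f (g x)) x v"
    if "x \<in> S" for x v
    using fderiv_compose[of g x f v] linear_euclidean_sum[of "fderiv f (g x)" "fderiv g x v"]
      linear_fderiv[of f "g x"] Suc.prems assms(2) that by auto
  have "Ck_on k S (\<lambda>x. (fderiv g x v \<bullet> b) *\<^sub>R fderiv f (g x) b)" for v b
  proof (rule Ck_on_scaleR[OF assms(1)])
    show "Ck_on k S (\<lambda>x. fderiv g x v \<bullet> b)"
      by (rule Ck_on_bounded_linear[OF assms(1) bounded_linear_inner_left]) (use Suc.prems in simp)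
    show "Ck_on k S (\<lambda>x. fderiv f (g x) b)"
      by (rule Suc.IH[OF _ Ck_on_SucD[OF Suc.prems(2)]]) (use Suc.prems in simp)
  qed
  then have "Ck_on k S (\<lambda>x. fderiv (\<lambda>x. f (g x)) x v)" for v
    by (intro Ck_on_cong[OF assms(1) eq] Ck_on_sum[OF assms(1)])
  moreover have "(\<lambda>x. f (g x)) differentiable (at x)" if "x \<in> S" for x
    using differentiable_chain_at[of g x f] Suc.prems assms(2) that by (auto simp: comp_def)
  ultimately show ?case by simp
qed

text \<open>The derivative of the reciprocal is a product of reciprocals of \<open>f\<close> and a
  derivative of \<open>f\<close>, so regularity of order \<open>k\<close> of the reciprocal itself
  yields order \<open>Suc k\<close>.\<close>

lemma Ck_on_inverse:
  fixes f :: "'a::euclidean_space \<Rightarrow> real"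
  assumes "open S" "\<And>x. x \<in> S \<Longrightarrow> f x \<noteq> 0"
  shows "Ck_on k S f \<Longrightarrow> Ck_on k S (\<lambda>x. inverse (f x))"
proof (induction k)
  case 0
  then show ?case using assms by (auto intro: continuous_on_inverse)
next
  case (Suc k)
  have D: "((\<lambda>x. inverse (f x)) has_derivative
      (\<lambda>v. - (inverse (f x) * fderiv f x v * inverse (f x)))) (at x)" if "x \<in> S" for x
    using Deriv.has_derivative_inverse[OF assms(2)[OF that] fderiv_works[of f]] Suc.prems that by auto
  have "Ck_on k S (\<lambda>x. (- 1) *\<^sub>R (inverse (f x) *\<^sub>R fderiv f x v *\<^sub>R inverse (f x)))" for v
    using Suc.prems Suc.IH[OF Ck_on_SucD[OF Suc.prems]]
    by (intro Ck_on_scaleR assms(1) Ck_on_const) auto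
  moreover have "(- 1) *\<^sub>R (inverse (f x) *\<^sub>R fderiv f x v *\<^sub>R inverse (f x))
      = fderiv (\<lambda>x. inverse (f x)) x v" if "x \<in> S" for x v
    using fderiv_eq[OF D[OF that], of v] by simp
  ultimately have "Ck_on k S (\<lambda>x. fderiv (\<lambda>x. inverse (f x)) x v)" for v
    by - (rule Ck_on_cong[OF assms(1)])
  with D show ?case by (auto intro: differentiableI)
qed

section \<open>Closure properties of smooth maps\<close>

lemma smooth_on_cong:
  assumes "open S" "smooth_on S f" "\<And>x. x \<in> S \<Longrightarrow> f x = g x"
  shows "smooth_on S g"
  using assms Ck_on_cong unfolding smooth_on_def by blast

lemma smooth_on_subset: "smooth_on S f \<Longrightarrow> T \<subseteq> S \<Longrightarrow> smooth_on T f"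
  using Ck_on_subset unfolding smooth_on_def by blast

lemma smooth_on_const: "smooth_on S (\<lambda>x. a)"
  by (simp add: smooth_on_def Ck_on_const)

lemma smooth_on_id: "smooth_on S (\<lambda>x. x)"
  unfolding smooth_on_def
proof
  fix k
  show "Ck_on k S (\<lambda>x. x)" by (cases k) (auto simp: Ck_on_const)
qed

lemma smooth_on_add:
  "open S \<Longrightarrow> smooth_on S f \<Longrightarrow> smooth_on S g \<Longrightarrow> smooth_on S (\<lambda>x. f x + g x)"
  by (simp add: smooth_on_def Ck_on_add)

lemma smooth_on_scaleR:
  "open S \<Longrightarrow> smooth_on S f \<Longrightarrow> smooth_on S g \<Longrightarrow> smooth_on S (\<lambda>x. f x *\<^sub>R g x)"
  by (simp add: smooth_on_def Ck_on_scaleR)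

lemma smooth_on_mult:
  fixes f g :: "'a::euclidean_space \<Rightarrow> real"
  shows "open S \<Longrightarrow> smooth_on S f \<Longrightarrow> smooth_on S g \<Longrightarrow> smooth_on S (\<lambda>x. f x * g x)"
  using smooth_on_scaleR[of S f g] by simp

lemma smooth_on_bounded_linear:
  "open S \<Longrightarrow> bounded_linear L \<Longrightarrow> smooth_on S f \<Longrightarrow> smooth_on S (\<lambda>x. L (f x))"
  by (simp add: smooth_on_def Ck_on_bounded_linear)

lemma smooth_on_minus: "open S \<Longrightarrow> smooth_on S f \<Longrightarrow> smooth_on S (\<lambda>x. - f x)"
  by (rule smooth_on_bounded_linear[OF _ bounded_linear_minus[OF bounded_linear_ident]])

lemma smooth_on_diff:
  "open S \<Longrightarrow> smooth_on S f \<Longrightarrow> smooth_on S g \<Longrightarrow> smooth_on S (\<lambda>x. f x - g x)"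
  using smooth_on_add[OF _ _ smooth_on_minus, of S f g] by simp

lemma smooth_on_sum:
  "open S \<Longrightarrow> (\<And>i. i \<in> I \<Longrightarrow> smooth_on S (f i)) \<Longrightarrow> smooth_on S (\<lambda>x. \<Sum>i\<in>I. f i x)"
  by (simp add: smooth_on_def Ck_on_sum)

lemma smooth_on_compose:
  fixes f :: "'b::euclidean_space \<Rightarrow> 'c::real_normed_vector"
  shows "open S \<Longrightarrow> (\<And>x. x \<in> S \<Longrightarrow> g x \<in> T) \<Longrightarrow> smooth_on T f \<Longrightarrow> smooth_on S g
    \<Longrightarrow> smooth_on S (\<lambda>x. f (g x))"
  unfolding smooth_on_def using Ck_on_compose[of S g T] by blast

lemma smooth_on_inverse:
  fixes f :: "'a::euclidean_space \<Rightarrow> real"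
  shows "open S \<Longrightarrow> (\<And>x. x \<in> S \<Longrightarrow> f x \<noteq> 0) \<Longrightarrow> smooth_on S f
    \<Longrightarrow> smooth_on S (\<lambda>x. inverse (f x))"
  unfolding smooth_on_def using Ck_on_inverse[of S f] by blast

lemma smooth_on_prod:
  fixes f :: "'i \<Rightarrow> 'a::euclidean_space \<Rightarrow> real"
  shows "open S \<Longrightarrow> (\<And>i. i \<in> I \<Longrightarrow> smooth_on S (f i)) \<Longrightarrow> smooth_on S (\<lambda>x. \<Prod>i\<in>I. f i x)"
  by (induction I rule: infinite_finite_induct) (auto intro: smooth_on_const smooth_on_mult)

lemma smooth_on_fderiv: "smooth_on S f \<Longrightarrow> smooth_on S (\<lambda>x. fderiv f x v)"
  unfolding smooth_on_def by (metis Ck_on.simps(2))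

lemma smooth_on_differentiable: "smooth_on S f \<Longrightarrow> x \<in> S \<Longrightarrow> f differentiable (at x)"
  unfolding smooth_on_def by (metis Ck_on.simps(2))

lemma smooth_on_continuous: "smooth_on S f \<Longrightarrow> continuous_on S f"
  unfolding smooth_on_def by (metis Ck_on.simps(1))

lemma smooth_on_vec_lambda:
  fixes f :: "'n::finite \<Rightarrow> 'a::euclidean_space \<Rightarrow> real"
  assumes "open S" "\<And>i. smooth_on S (f i)"
  shows "smooth_on S (\<lambda>x. \<chi> i. f i x)"
proof -
  have "(\<Sum>i\<in>UNIV. f i x *\<^sub>R axis i 1) = (\<chi> i. f i x)" for x
    by (simp add: vec_eq_iff axis_def if_distrib cong: if_cong)
  moreover have "smooth_on S (\<lambda>x. \<Sum>i\<in>UNIV. f i x *\<^sub>R (axis i 1 :: real^'n))"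
    using assms by (intro smooth_on_sum smooth_on_scaleR smooth_on_const)
  ultimately show ?thesis by simp
qed

lemma smooth_on_det:
  fixes f :: "'n::finite \<Rightarrow> 'n \<Rightarrow> 'a::euclidean_space \<Rightarrow> real"
  assumes "open S" "\<And>i j. smooth_on S (f i j)"
  shows "smooth_on S (\<lambda>x. det (\<chi> i j. f i j x))"
  unfolding det_def
  by (auto intro!: assms smooth_on_sum smooth_on_mult smooth_on_const smooth_on_prod)

text \<open>Both mixed derivatives are limits of the same second difference quotient.\<close>

lemma second_difference_mvt:
  fixes f :: "'a::euclidean_space \<Rightarrow> real"
  assumes "smooth_on S f" "t > 0"
    and S: "\<And>a b. a \<in> {0..t} \<Longrightarrow> b \<in> {0..t} \<Longrightarrow> x + a *\<^sub>R u + b *\<^sub>R v \<in> S"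
  shows "\<exists>a\<in>{0..t}. \<exists>b\<in>{0..t}. f (x + t *\<^sub>R u + t *\<^sub>R v) - f (x + t *\<^sub>R u) - f (x + t *\<^sub>R v) + f x
    = t * t * fderiv (\<lambda>y. fderiv f y u) (x + a *\<^sub>R u + b *\<^sub>R v) v"
proof -
  \<comment> \<open>\<open>p\<close> is the increment of \<open>f\<close> along the side
    \<open>t *\<^sub>R v\<close>. The mean value theorem for \<open>p\<close> produces
    \<open>a\<close>, and a second one, for the derivative of \<open>f\<close> in direction
    \<open>u\<close>, produces \<open>b\<close>.\<close>
  define p where "p a = f (x + a *\<^sub>R u + t *\<^sub>R v) - f (x + a *\<^sub>R u)" for a
  have D: "((\<lambda>a. g (z + a *\<^sub>R w)) has_real_derivative fderiv g (z + a *\<^sub>R w) w) (at a)"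
    if "g differentiable (at (z + a *\<^sub>R w))" for g :: "'a \<Rightarrow> real" and a z w
  proof -
    have "((\<lambda>a. g (z + a *\<^sub>R w)) has_derivative (\<lambda>h. fderiv g (z + a *\<^sub>R w) (h *\<^sub>R w))) (at a)"
      by (rule has_derivative_compose[where g = g and f = "\<lambda>a. z + a *\<^sub>R w"
            and f' = "\<lambda>h. h *\<^sub>R w", OF _ fderiv_works[OF that]])
        (auto intro!: derivative_eq_intros)
    then show ?thesis
      by (simp add: has_field_derivative_def linear_scale[OF linear_fderiv[OF that]]
          mult.commute[of _ "fderiv _ _ _"])
  qed
  have fd: "f differentiable (at y)" "(\<lambda>y. fderiv f y u) differentiable (at y)" if "y \<in> S" for y
    using assms(1) that by (auto intro: smooth_on_differentiable smooth_on_fderiv)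
  have pd: "(p has_real_derivative fderiv f (x + a *\<^sub>R u + t *\<^sub>R v) u - fderiv f (x + a *\<^sub>R u) u) (at a)"
    if "0 \<le> a" "a \<le> t" for a
    unfolding p_def
    using D[of f "x + t *\<^sub>R v" a u] D[of f x a u] S[of a t] S[of a 0] that assms(2) fd
    by (intro DERIV_diff) (simp_all add: algebra_simps)
  obtain a where a: "0 < a" "a < t"
    and pa: "p t - p 0 = t * (fderiv f (x + a *\<^sub>R u + t *\<^sub>R v) u - fderiv f (x + a *\<^sub>R u) u)"
    using MVT2[OF assms(2) pd] by auto
  have "((\<lambda>b. fderiv f (x + a *\<^sub>R u + b *\<^sub>R v) u) has_real_derivative
      fderiv (\<lambda>y. fderiv f y u) (x + a *\<^sub>R u + b *\<^sub>R v) v) (at b)" if "0 \<le> b" "b \<le> t" for b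
    using D[of "\<lambda>y. fderiv f y u" "x + a *\<^sub>R u" b v] S[of a b] a that fd by auto
  from MVT2[OF assms(2) this] obtain b where b: "0 < b" "b < t"
    and "fderiv f (x + a *\<^sub>R u + t *\<^sub>R v) u - fderiv f (x + a *\<^sub>R u) u
      = t * fderiv (\<lambda>y. fderiv f y u) (x + a *\<^sub>R u + b *\<^sub>R v) v"
    by auto
  with pa a b show ?thesis unfolding p_def
    by (intro bexI[of _ a] bexI[of _ b]) (auto simp: algebra_simps)
qed

lemma fderiv_commute_real:
  fixes f :: "'a::euclidean_space \<Rightarrow> real"
  assumes "open S" "smooth_on S f" "x \<in> S"
  shows "fderiv (\<lambda>y. fderiv f y u) x v = fderiv (\<lambda>y. fderiv f y v) x u"
proof (rule ccontr)
  define P Q where "P y = fderiv (\<lambda>y. fderiv f y u) y v"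
    and "Q y = fderiv (\<lambda>y. fderiv f y v) y u" for y
  \<comment> \<open>Half the gap: values within \<open>e\<close> of \<open>P x\<close> and of
    \<open>Q x\<close> cannot coincide.\<close>
  define e where "e = \<bar>P x - Q x\<bar> / 2"
  assume "fderiv (\<lambda>y. fderiv f y u) x v \<noteq> fderiv (\<lambda>y. fderiv f y v) x u"
  then have "e > 0" by (simp add: e_def P_def Q_def)
  have "isCont P x" "isCont Q x"
    using assms unfolding P_def Q_def
    by (metis smooth_on_fderiv smooth_on_continuous continuous_on_eq_continuous_at)+
  then obtain d1 d2 where d1: "d1 > 0" "\<And>y. dist y x < d1 \<Longrightarrow> dist (P y) (P x) < e"
    and d2: "d2 > 0" "\<And>y. dist y x < d2 \<Longrightarrow> dist (Q y) (Q x) < e"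
    unfolding continuous_at_eps_delta using \<open>e > 0\<close> by (metis dist_norm)
  obtain d3 where d3: "d3 > 0" "ball x d3 \<subseteq> S" using assms openE by blast
  define d where "d = min d1 (min d2 d3)"
  \<comment> \<open>This keeps the whole parallelogram with sides \<open>t *\<^sub>R u\<close> and
    \<open>t *\<^sub>R v\<close> within distance \<open>d\<close> of \<open>x\<close>; the summand 1
    makes the denominator positive when \<open>u\<close> and \<open>v\<close> vanish.\<close>
  define t where "t = d / (2 * (norm u + norm v + 1))"
  have "d > 0" using d1 d2 d3 by (simp add: d_def)
  then have "t > 0" by (simp add: t_def add_nonneg_pos)
  have small: "dist (x + a *\<^sub>R u + b *\<^sub>R v) x < d" if "a \<in> {0..t}" "b \<in> {0..t}" for a b
  proof -
    have "dist (x + a *\<^sub>R u + b *\<^sub>R v) x \<le> a * norm u + b * norm v"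
      using norm_triangle_ineq[of "a *\<^sub>R u" "b *\<^sub>R v"] that by (simp add: dist_norm algebra_simps)
    also have "\<dots> \<le> t * norm u + t * norm v"
      using that by (intro add_mono mult_right_mono) auto
    also have "\<dots> < t * (2 * (norm u + norm v + 1))"
      using \<open>t > 0\<close> by (simp add: algebra_simps add_pos_nonneg add_nonneg_pos)
    also have "\<dots> = d"
      using add_nonneg_pos[of "norm u + norm v" 1] unfolding t_def
      by (simp add: add_nonneg_eq_0_iff)
    finally show ?thesis .
  qed
  have inS: "x + a *\<^sub>R u + b *\<^sub>R v \<in> S" "x + b *\<^sub>R v + a *\<^sub>R u \<in> S"
    if "a \<in> {0..t}" "b \<in> {0..t}" for a b
    using small[OF that] d3 by (auto simp: d_def dist_commute algebra_simps subset_iff)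
  from second_difference_mvt[OF assms(2) \<open>t > 0\<close> inS(1)]
  obtain a b where ab: "a \<in> {0..t}" "b \<in> {0..t}" and
    1: "f (x + t *\<^sub>R u + t *\<^sub>R v) - f (x + t *\<^sub>R u) - f (x + t *\<^sub>R v) + f x
      = t * t * P (x + a *\<^sub>R u + b *\<^sub>R v)"
    unfolding P_def by blast
  from second_difference_mvt[OF assms(2) \<open>t > 0\<close> inS(2)]
  obtain a' b' where ab': "a' \<in> {0..t}" "b' \<in> {0..t}" and
    2: "f (x + t *\<^sub>R v + t *\<^sub>R u) - f (x + t *\<^sub>R v) - f (x + t *\<^sub>R u) + f x
      = t * t * Q (x + b' *\<^sub>R v + a' *\<^sub>R u)"
    unfolding Q_def by blast
  have "t * t * P (x + a *\<^sub>R u + b *\<^sub>R v) = t * t * Q (x + a' *\<^sub>R u + b' *\<^sub>R v)"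
    using 1 2 by (simp add: algebra_simps)
  then have "P (x + a *\<^sub>R u + b *\<^sub>R v) = Q (x + a' *\<^sub>R u + b' *\<^sub>R v)"
    using \<open>t > 0\<close> by simp
  moreover have "dist (P (x + a *\<^sub>R u + b *\<^sub>R v)) (P x) < e"
    using d1 small[OF ab] by (simp add: d_def)
  moreover have "dist (Q (x + a' *\<^sub>R u + b' *\<^sub>R v)) (Q x) < e"
    using d2 small[OF ab'] by (simp add: d_def)
  ultimately show False
    unfolding e_def dist_real_def by (simp add: abs_if split: if_splits)
qed

lemma fderiv_bounded_linear:
  assumes "bounded_linear L" "f differentiable (at x)"
  shows "fderiv (\<lambda>x. L (f x)) x v = L (fderiv f x v)"
  by (rule fderiv_eq[OF bounded_linear.has_derivative[OF assms(1) fderiv_works[OF assms(2)]]])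

lemma fderiv_commute:
  fixes f :: "'a::euclidean_space \<Rightarrow> 'b::euclidean_space"
  assumes "open S" "smooth_on S f" "x \<in> S"
  shows "fderiv (\<lambda>y. fderiv f y u) x v = fderiv (\<lambda>y. fderiv f y v) x u"
proof (rule euclidean_eqI)
  fix b :: 'b
  have bl: "bounded_linear (\<lambda>z::'b. z \<bullet> b)" by (rule bounded_linear_inner_left)
  have *: "fderiv (\<lambda>y. fderiv (\<lambda>z. f z \<bullet> b) y u) x v = fderiv (\<lambda>y. fderiv f y u) x v \<bullet> b" for u v
  proof -
    have "fderiv (\<lambda>y. fderiv (\<lambda>z. f z \<bullet> b) y u) x v = fderiv (\<lambda>y. fderiv f y u \<bullet> b) x v"
      using assms
      by (intro fderiv_cong_open[of S]) (auto intro: fderiv_bounded_linear[OF bl] smooth_on_differentiable)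
    also have "\<dots> = fderiv (\<lambda>y. fderiv f y u) x v \<bullet> b"
      using assms by (intro fderiv_bounded_linear[OF bl] smooth_on_differentiable smooth_on_fderiv)
    finally show ?thesis .
  qed
  show "fderiv (\<lambda>y. fderiv f y u) x v \<bullet> b = fderiv (\<lambda>y. fderiv f y v) x u \<bullet> b"
    using fderiv_commute_real[OF assms(1) smooth_on_bounded_linear[OF assms(1) bl assms(2)] assms(3)] *
    by metis
qed

subsection \<open>Inner products depending on a point\<close>

lemma bilinear_euclidean_sum:
  fixes B :: "'b::euclidean_space \<Rightarrow> 'c::euclidean_space \<Rightarrow> 'd::real_vector"
  assumes "bilinear B"
  shows "B v w = (\<Sum>i\<in>Basis. \<Sum>j\<in>Basis. ((v \<bullet> i) * (w \<bullet> j)) *\<^sub>R B i j)"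
proof -
  have "B v w = (\<Sum>i\<in>Basis. (v \<bullet> i) *\<^sub>R B i w)"
    using assms linear_euclidean_sum[of "\<lambda>v. B v w" v] by (simp add: bilinear_def)
  also have "\<dots> = (\<Sum>i\<in>Basis. (v \<bullet> i) *\<^sub>R (\<Sum>j\<in>Basis. (w \<bullet> j) *\<^sub>R B i j))"
    using assms linear_euclidean_sum[of "B i" w for i] by (simp add: bilinear_def)
  finally show ?thesis by (simp add: scaleR_right.sum)
qed

text \<open>A product rule with three moving parts. Differentiability of \<open>B\<close> is
  available only for fixed arguments, so \<open>V\<close> and \<open>W\<close> are expanded in
  \<open>Basis\<close> and the scalar product rule is applied to each coefficient.\<close>

lemma has_derivative_bilinear_family:
  fixes B :: "'a::euclidean_space \<Rightarrow> 'b::euclidean_space \<Rightarrow> 'c::euclidean_space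
      \<Rightarrow> 'd::real_normed_vector"
  assumes S: "open S" "x \<in> S" "\<And>y. y \<in> S \<Longrightarrow> bilinear (B y)"
    and B: "\<And>v w. (\<lambda>y. B y v w) differentiable (at x)"
    and V: "V differentiable (at x)" and W: "W differentiable (at x)"
  shows "((\<lambda>y. B y (V y) (W y)) has_derivative (\<lambda>u. fderiv (\<lambda>y. B y (V x) (W x)) x u
    + B x (fderiv V x u) (W x) + B x (V x) (fderiv W x u))) (at x)"
proof -
  have D: "((\<lambda>y. B y (V y) (W y)) has_derivative (\<lambda>u.
       (\<Sum>i\<in>Basis. \<Sum>j\<in>Basis. ((V x \<bullet> i) * (W x \<bullet> j)) *\<^sub>R fderiv (\<lambda>y. B y i j) x u)
     + B x (fderiv V x u) (W x) + B x (V x) (fderiv W x u))) (at x)"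
    if V: "V differentiable (at x)" and W: "W differentiable (at x)" for V W
  proof (rule has_derivative_transform_within_open[OF _ S(1,2)])
    have VW: "((\<lambda>y. ((V y \<bullet> i) * (W y \<bullet> j)) *\<^sub>R B y i j) has_derivative (\<lambda>u.
        ((V x \<bullet> i) * (W x \<bullet> j)) *\<^sub>R fderiv (\<lambda>y. B y i j) x u
        + ((V x \<bullet> i) * (fderiv W x u \<bullet> j) + (fderiv V x u \<bullet> i) * (W x \<bullet> j)) *\<^sub>R B x i j)) (at x)"
      for i j
      by (rule has_derivative_scaleR has_derivative_mult has_derivative_inner_left
          fderiv_works assms V W)+
    show "((\<lambda>y. \<Sum>i\<in>Basis. \<Sum>j\<in>Basis. ((V y \<bullet> i) * (W y \<bullet> j)) *\<^sub>R B y i j) has_derivative (\<lambda>u.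
       (\<Sum>i\<in>Basis. \<Sum>j\<in>Basis. ((V x \<bullet> i) * (W x \<bullet> j)) *\<^sub>R fderiv (\<lambda>y. B y i j) x u)
     + B x (fderiv V x u) (W x) + B x (V x) (fderiv W x u))) (at x)"
      by (rule has_derivative_eq_rhs, (rule has_derivative_sum)+, rule VW)
        (simp add: bilinear_euclidean_sum[OF S(3)[OF S(2)], of _ "W x"]
          bilinear_euclidean_sum[OF S(3)[OF S(2)], of "V x"]
          sum.distrib scaleR_add_left algebra_simps fun_eq_iff)
    show "\<And>y. y \<in> S \<Longrightarrow> (\<Sum>i\<in>Basis. \<Sum>j\<in>Basis. ((V y \<bullet> i) * (W y \<bullet> j)) *\<^sub>R B y i j) = B y (V y) (W y)"
      by (rule bilinear_euclidean_sum[OF S(3), symmetric])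
  qed
  have "bilinear (B x)" using S by blast
  \<comment> \<open>\<open>D\<close> for the constant fields with values \<open>V x\<close> and
    \<open>W x\<close> identifies the double sum as the derivative of the form with frozen
    arguments.\<close>
  then have "fderiv (\<lambda>y. B y (V x) (W x)) x u
    = (\<Sum>i\<in>Basis. \<Sum>j\<in>Basis. ((V x \<bullet> i) * (W x \<bullet> j)) *\<^sub>R fderiv (\<lambda>y. B y i j) x u)" for u
    using fderiv_eq[OF D[of "\<lambda>_. V x" "\<lambda>_. W x"], of u]
    by (simp add: bilinear_lzero bilinear_rzero)
  with D[OF V W] show ?thesis by simp
qed

lemmas fderiv_bilinear_family = fderiv_eq[OF has_derivative_bilinear_family]

lemma smooth_on_bilinear_family:
  fixes B :: "'a::euclidean_space \<Rightarrow> 'b::euclidean_space \<Rightarrow> 'c::euclidean_space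
      \<Rightarrow> 'd::real_normed_vector"
  assumes "open S" "\<And>y. y \<in> S \<Longrightarrow> bilinear (B y)" "\<And>v w. smooth_on S (\<lambda>y. B y v w)"
    and "smooth_on S V" "smooth_on S W"
  shows "smooth_on S (\<lambda>y. B y (V y) (W y))"
proof (rule smooth_on_cong[OF assms(1)])
  show "smooth_on S (\<lambda>y. \<Sum>i\<in>Basis. \<Sum>j\<in>Basis. ((V y \<bullet> i) * (W y \<bullet> j)) *\<^sub>R B y i j)"
    by (rule smooth_on_sum smooth_on_scaleR smooth_on_mult assms
        smooth_on_bounded_linear[OF _ bounded_linear_inner_left])+
  show "(\<Sum>i\<in>Basis. \<Sum>j\<in>Basis. ((V y \<bullet> i) * (W y \<bullet> j)) *\<^sub>R B y i j) = B y (V y) (W y)"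
    if "y \<in> S" for y
    by (rule bilinear_euclidean_sum[OF assms(2)[OF that], symmetric])
qed

text \<open>Makes a family of linear maps a special case of a bilinear one: the first slot is real
  and is held at the value 1.\<close>

lemma bilinear_scaleR_linear: "linear L \<Longrightarrow> bilinear (\<lambda>(r::real) w. r *\<^sub>R L w)"
  by (simp add: bilinear_def linear_iff algebra_simps)

lemma has_derivative_linear_family:
  fixes L :: "'a::euclidean_space \<Rightarrow> 'b::euclidean_space \<Rightarrow> 'd::real_normed_vector"
  assumes S: "open S" "x \<in> S" "\<And>y. y \<in> S \<Longrightarrow> linear (L y)"
    and L: "\<And>w. (\<lambda>y. L y w) differentiable (at x)" and W: "W differentiable (at x)"
  shows "((\<lambda>y. L y (W y)) has_derivative
    (\<lambda>u. fderiv (\<lambda>y. L y (W x)) x u + L x (fderiv W x u))) (at x)"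
  using has_derivative_bilinear_family[where B = "\<lambda>y (r::real) w. r *\<^sub>R L y w" and V = "\<lambda>_. 1", OF S(1,2)
      bilinear_scaleR_linear[OF S(3)] _ _ W] L
  by (simp add: fun_eq_iff)

lemmas fderiv_linear_family = fderiv_eq[OF has_derivative_linear_family]

lemma smooth_on_linear_family:
  fixes L :: "'a::euclidean_space \<Rightarrow> 'b::euclidean_space \<Rightarrow> 'd::real_normed_vector"
  assumes "open S" "\<And>y. y \<in> S \<Longrightarrow> linear (L y)" "\<And>w. smooth_on S (\<lambda>y. L y w)" "smooth_on S W"
  shows "smooth_on S (\<lambda>y. L y (W y))"
  using smooth_on_bilinear_family[where B = "\<lambda>y (r::real) w. r *\<^sub>R L y w" and V = "\<lambda>_. 1", OF assms(1)
      bilinear_scaleR_linear[OF assms(2)]] assms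
  by (simp add: smooth_on_const smooth_on_scaleR)

lemma linear_fderiv_family:
  fixes L :: "'a::euclidean_space \<Rightarrow> 'b::real_vector \<Rightarrow> 'd::real_normed_vector"
  assumes S: "open S" "x \<in> S" "\<And>y. y \<in> S \<Longrightarrow> linear (L y)"
    and L: "\<And>w. (\<lambda>y. L y w) differentiable (at x)"
  shows "linear (\<lambda>w. fderiv (\<lambda>y. L y w) x u)"
proof (rule linearI)
  fix v w and r :: real
  have "fderiv (\<lambda>y. L y (v + w)) x u = fderiv (\<lambda>y. L y v + L y w) x u"
    using S by (intro fderiv_cong_open[OF S(1,2)]) (simp add: linear_add)
  then show "fderiv (\<lambda>y. L y (v + w)) x u = fderiv (\<lambda>y. L y v) x u + fderiv (\<lambda>y. L y w) x u"
    using fderiv_eq[OF has_derivative_add[OF fderiv_works[OF L] fderiv_works[OF L]]] by simp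
  have "fderiv (\<lambda>y. L y (r *\<^sub>R w)) x u = fderiv (\<lambda>y. r *\<^sub>R L y w) x u"
    using S by (intro fderiv_cong_open[OF S(1,2)]) (simp add: linear_scale)
  then show "fderiv (\<lambda>y. L y (r *\<^sub>R w)) x u = r *\<^sub>R fderiv (\<lambda>y. L y w) x u"
    using fderiv_eq[OF has_derivative_scaleR_right[OF fderiv_works[OF L]]] by simp
qed

lemma linear_axis_sum:
  fixes f :: "real^'m \<Rightarrow> 'b::real_vector"
  assumes "linear f"
  shows "f v = (\<Sum>k\<in>UNIV. v $ k *\<^sub>R f (axis k 1))"
proof -
  have "(\<Sum>k\<in>UNIV. v $ k *\<^sub>R axis k 1) = v"
    by (simp add: vec_eq_iff axis_def if_distrib cong: if_cong)
  then have "f v = f (\<Sum>k\<in>UNIV. v $ k *\<^sub>R axis k 1)" by simp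
  then show ?thesis by (simp add: linear_sum[OF assms] linear_scale[OF assms])
qed

section \<open>Linear algebra of the metric at one point: Gram matrix, orthonormal bases,
  traces\<close>

locale inner_form =
  fixes b :: "real^'m \<Rightarrow> real^'m \<Rightarrow> real"
  assumes bilinear: "bilinear b"
    and sym: "b u v = b v u"
    and pos: "u \<noteq> 0 \<Longrightarrow> b u u > 0"
begin

lemma linear_right: "linear (b u)" and linear_left: "linear (\<lambda>v. b v u)"
  using bilinear by (auto simp: bilinear_def)

lemmas ops =
  linear_add[OF linear_right] linear_add[OF linear_left]
  linear_scale[OF linear_right] linear_scale[OF linear_left]
  linear_diff[OF linear_right] linear_diff[OF linear_left]
  linear_neg[OF linear_right] linear_neg[OF linear_left]
  linear_0[OF linear_right] linear_0[OF linear_left]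
  linear_sum[OF linear_right] linear_sum[OF linear_left]

lemma nondegenerate: "(\<And>z. b v z = b w z) \<Longrightarrow> v = w"
  using pos[of "v - w"] by (force simp: ops)

lemma gram_mult: "((\<chi> k l. b (axis k 1) (axis l 1)) *v w) $ k = b (axis k 1) w"
  using linear_axis_sum[OF linear_right, of "axis k 1" w]
  by (simp add: matrix_vector_mult_def mult.commute)

lemma linear_form_eqI:
  fixes \<alpha> \<beta> :: "real^'m \<Rightarrow> real"
  assumes "linear \<alpha>" "linear \<beta>" "\<And>i. \<alpha> (axis i 1) = \<beta> (axis i 1)"
  shows "\<alpha> z = \<beta> z"
  using linear_axis_sum[OF assms(1), of z] linear_axis_sum[OF assms(2), of z] assms(3) by simp

lemma gram_det_nonzero: "det (\<chi> k l. b (axis k 1) (axis l 1)) \<noteq> 0"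
proof -
  let ?A = "\<chi> k l. b (axis k 1) (axis l 1)"
  have "w = 0" if "?A *v w = 0" for w
  proof (rule nondegenerate)
    fix z
    show "b w z = b 0 z"
    proof (rule linear_form_eqI[OF linear_right linear_right])
      fix k
      have "b w (axis k 1) = b (axis k 1) w" by (rule sym)
      also have "\<dots> = 0" using gram_mult[of w k] that by simp
      finally show "b w (axis k 1) = b 0 (axis k 1)" by (simp add: linear_0[OF linear_left])
    qed
  qed
  then have "invertible ?A"
    by (simp add: invertible_left_inverse matrix_left_invertible_ker)
  then show ?thesis by (simp add: invertible_det_nz)
qed

lemma sharp_eqI: "(\<And>z. b w z = \<alpha> z) \<Longrightarrow> sharp b \<alpha> = w"
  unfolding sharp_def by (rule the_equality) (auto intro: nondegenerate)

text \<open>Cramer's rule for the Gram system. Besides existence it gives an explicit quotient of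
  determinants in the entries of \<open>b\<close> and \<open>\<alpha>\<close>, from which smooth
  dependence of \<open>sharp\<close> on the point is later read off.\<close>

lemma sharp_cramer_works:
  assumes "linear \<alpha>"
  defines "w \<equiv> (\<chi> k. det (\<chi> i j. if j = k then \<alpha> (axis i 1) else b (axis i 1) (axis j 1))
      / det (\<chi> k l. b (axis k 1) (axis l 1)))"
  shows "b w z = \<alpha> z"
proof (rule linear_form_eqI)
  fix i
  have "(\<chi> k l. b (axis k 1) (axis l 1)) *v w = (\<chi> i. \<alpha> (axis i 1))"
    by (subst cramer[OF gram_det_nonzero]) (simp add: w_def cong: if_cong)
  then show "b w (axis i 1) = \<alpha> (axis i 1)"
    using gram_mult[of w i] sym by simp
qed (simp_all add: linear_right assms(1))

lemmas sharp_cramer = sharp_eqI[OF sharp_cramer_works]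

lemma sharp_works: "linear \<alpha> \<Longrightarrow> b (sharp b \<alpha>) z = \<alpha> z"
  by (simp only: sharp_cramer sharp_cramer_works)

text \<open>Gram-Schmidt, one vector at a time: fewer than \<open>CARD('m)\<close> vectors do not
  span, so some \<open>w\<close> lies outside their span, and its part orthogonal to
  \<open>S\<close> is nonzero and can be normalised.\<close>

lemma orthonormal_set_extend:
  "k \<le> CARD('m) \<Longrightarrow> \<exists>S. finite S \<and> card S = k \<and> (\<forall>u\<in>S. \<forall>v\<in>S. b u v = (if u = v then 1 else 0))"
proof (induction k)
  case 0
  show ?case by (rule exI[of _ "{}"]) auto
next
  case (Suc k)
  then obtain S where S: "finite S" "card S = k" "\<And>u v. u \<in> S \<Longrightarrow> v \<in> S \<Longrightarrow> b u v = (if u = v then 1 else 0)"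
    by auto
  have "dim S < CARD('m)"
    using dim_le_card[of S S] S Suc.prems by (simp add: span_superset)
  then have "span S \<noteq> UNIV"
    by (metis dim_span dim_UNIV DIM_cart DIM_real mult.right_neutral less_irrefl)
  then obtain w where w: "w \<notin> span S" by blast
  define w' where "w' = w - (\<Sum>s\<in>S. b w s *\<^sub>R s)"
  have "w' \<noteq> 0"
  proof
    assume "w' = 0"
    then have "w = (\<Sum>s\<in>S. b w s *\<^sub>R s)" by (simp add: w'_def)
    also have "\<dots> \<in> span S" by (intro span_sum span_scale span_base)
    finally show False using w by simp
  qed
  then have p: "b w' w' > 0" by (rule pos)
  have orth: "b w' s = 0" if "s \<in> S" for s
  proof -
    have "(\<Sum>r\<in>S. b w r * b r s) = (\<Sum>r\<in>S. if r = s then b w s else 0)"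
      using that S(3) by (intro sum.cong) auto
    then show ?thesis using that S(1) by (simp add: w'_def ops)
  qed
  define e where "e = (1 / sqrt (b w' w')) *\<^sub>R w'"
  have e1: "b e e = 1" using p by (simp add: e_def ops real_div_sqrt)
  have e2: "b e s = 0" if "s \<in> S" for s using orth[OF that] by (simp add: e_def ops)
  then have e3: "b s e = 0" if "s \<in> S" for s using that by (simp add: sym[of s e])
  note e = e1 e2 e3
  have "e \<notin> S" using e1 e2 by fastforce
  moreover from this S(1,2) have "finite (insert e S)" "card (insert e S) = Suc k" by auto
  moreover have "\<forall>u\<in>insert e S. \<forall>v\<in>insert e S. b u v = (if u = v then 1 else 0)"
    using e S(3) \<open>e \<notin> S\<close> by auto
  ultimately show ?case by blast
qed

lemma orthonormal_basis_exists:
  obtains e :: "'m \<Rightarrow> real^'m" where "\<And>i j. b (e i) (e j) = (if i = j then 1 else 0)"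
proof -
  obtain S where S: "finite S" "card S = CARD('m)"
    "\<And>u v. u \<in> S \<Longrightarrow> v \<in> S \<Longrightarrow> b u v = (if u = v then 1 else 0)"
    using orthonormal_set_extend[of "CARD('m)"] by auto
  obtain e :: "'m \<Rightarrow> real^'m" where e: "bij_betw e UNIV S"
    using finite_same_card_bij[of "UNIV::'m set" S] S by auto
  have "b (e i) (e j) = (if i = j then 1 else 0)" for i j
    using S(3)[of "e i" "e j"] e by (auto simp: bij_betw_def inj_def)
  with that show ?thesis by blast
qed

text \<open>The left side is \<open>b v v\<close> times the squared length of the component
  \<open>w\<close> of \<open>u\<close> orthogonal to \<open>v\<close>. It is the denominator of the
  sectional curvature.\<close>

lemma cauchy_schwarz_strict:
  assumes "u \<noteq> v" "independent {u, v}"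
  shows "b u u * b v v - (b u v)\<^sup>2 > 0"
proof -
  have "v \<noteq> 0" using assms dependent_zero by blast
  then have v: "b v v > 0" by (rule pos)
  define w where "w = u - (b u v / b v v) *\<^sub>R v"
  have "u \<notin> span {v}"
    using assms by (simp add: independent_insert)
  then have "w \<noteq> 0" unfolding w_def
    by (metis right_minus_eq span_base span_scale singletonI)
  then have "b w w > 0" by (rule pos)
  moreover have "b w w = b u u - (b u v)\<^sup>2 / b v v"
    using v by (simp add: w_def ops sym[of v u] power2_eq_square field_simps)
  ultimately show ?thesis using v by (simp add: field_simps)
qed

context
  fixes e :: "'m \<Rightarrow> real^'m"
  assumes e: "\<And>i j. b (e i) (e j) = (if i = j then 1 else 0)"
begin

text \<open>The coordinate map \<open>T\<close> is linear and onto, since it recovers any prescribed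
  coefficients. Between spaces of equal dimension it is therefore injective, and both sides have the
  same coordinates.\<close>

lemma orthonormal_expansion: "(\<Sum>i\<in>UNIV. b v (e i) *\<^sub>R e i) = v"
proof -
  define T where "T z = (\<chi> i. b z (e i))" for z
  have lin: "linear T"
    by (rule linearI) (simp_all add: T_def ops vec_eq_iff)
  have "T (\<Sum>i\<in>UNIV. y $ i *\<^sub>R e i) = y" for y
    by (simp add: T_def ops e vec_eq_iff if_distrib cong: if_cong)
  then have "inj T"
    by (intro linear_surjective_imp_injective[OF lin] surjI) simp_all
  moreover have "T (\<Sum>i\<in>UNIV. b v (e i) *\<^sub>R e i) = T v"
    by (simp add: T_def ops e vec_eq_iff if_distrib cong: if_cong)
  ultimately show ?thesis by (simp add: inj_eq)
qed

lemma parseval: "b v w = (\<Sum>i\<in>UNIV. b v (e i) * b w (e i))"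
proof -
  have "b v w = b v (\<Sum>i\<in>UNIV. b w (e i) *\<^sub>R e i)"
    by (simp add: orthonormal_expansion)
  then show ?thesis by (simp add: ops mult.commute)
qed

lemma metric_trace_orthonormal:
  fixes B :: "real^'m \<Rightarrow> real^'m \<Rightarrow> 'v::real_vector"
  assumes "bilinear B"
  shows "metric_trace b B = (\<Sum>a\<in>UNIV. B (e a) (e a))"
proof -
  let ?A = "\<chi> k l. b (axis k 1) (axis l 1)"
  have lin: "linear (B v)" "linear (\<lambda>u. B u v)" for v using assms by (auto simp: bilinear_def)
  have "invertible ?A" using gram_det_nonzero by (simp add: invertible_det_nz)
  then have A_inv: "?A ** matrix_inv ?A = mat 1"
    unfolding invertible_def matrix_inv_def by (rule someI2_ex) simp
  \<comment> \<open>The dual basis of the coordinate axes with respect to \<open>b\<close>: pairing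
    with \<open>E j\<close> reads off the coordinate \<open>j\<close>. It absorbs the inverse Gram
    matrix in \<open>metric_trace\<close>.\<close>
  define E where "E j = (\<Sum>i\<in>UNIV. matrix_inv ?A $ i $ j *\<^sub>R axis i (1::real))" for j :: 'm
  have sum_e: "(\<Sum>i\<in>UNIV. v $ i *\<^sub>R axis i 1) = v" for v :: "real^'m"
    by (simp add: vec_eq_iff axis_def if_distrib cong: if_cong)
  have E: "b (E j) z = z $ j" for j z
  proof (rule linear_form_eqI)
    fix k
    have "b (E j) (axis k 1) = b (axis k 1) (E j)" by (rule sym)
    also have "\<dots> = (?A ** matrix_inv ?A) $ k $ j"
      by (simp add: E_def ops matrix_matrix_mult_def mult.commute)
    finally
    show "b (E j) (axis k 1) = axis k 1 $ j"
      by (simp only: A_inv) (simp add: mat_def axis_def)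
  qed (simp_all add: linear_right linearI)
  have "metric_trace b B = (\<Sum>j\<in>UNIV. B (E j) (axis j 1))"
    unfolding metric_trace_def E_def
    by (subst sum.swap) (simp add: linear_sum[OF lin(2)] linear_scale[OF lin(2)])
  also have "\<dots> = (\<Sum>j\<in>UNIV. B (\<Sum>a\<in>UNIV. b (E j) (e a) *\<^sub>R e a) (axis j 1))"
    by (simp add: orthonormal_expansion)
  also have "\<dots> = (\<Sum>a\<in>UNIV. \<Sum>j\<in>UNIV. e a $ j *\<^sub>R B (e a) (axis j 1))"
    by (subst sum.swap) (simp add: E linear_sum[OF lin(2)] linear_scale[OF lin(2)])
  also have "\<dots> = (\<Sum>a\<in>UNIV. B (e a) (\<Sum>j\<in>UNIV. e a $ j *\<^sub>R axis j 1))"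
    by (simp add: linear_sum[OF lin(1)] linear_scale[OF lin(1)])
  finally show ?thesis by (simp add: sum_e)
qed

lemma trace_orthonormal:
  assumes "linear L"
  shows "trace (matrix L) = (\<Sum>a\<in>UNIV. b (e a) (L (e a)))"
proof -
  have L: "b (e a) (L z) = (\<Sum>j\<in>UNIV. z $ j * b (e a) (L (axis j 1)))" for a z
  proof -
    have z: "(\<Sum>i\<in>UNIV. z $ i *\<^sub>R axis i 1) = z"
      by (simp add: vec_eq_iff axis_def if_distrib cong: if_cong)
    have "b (e a) (L z) = b (e a) (L (\<Sum>i\<in>UNIV. z $ i *\<^sub>R axis i 1))" by (simp only: z)
    then show ?thesis by (simp add: linear_sum[OF assms] linear_scale[OF assms] ops)
  qed
  have "L (axis j 1) $ j = (\<Sum>a\<in>UNIV. e a $ j * b (e a) (L (axis j 1)))" for j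
  proof -
    have "L (axis j 1) $ j = (\<Sum>a\<in>UNIV. b (L (axis j 1)) (e a) *\<^sub>R e a) $ j"
      by (simp only: orthonormal_expansion)
    then show ?thesis by (simp add: sym[of "L _"] mult.commute)
  qed
  then have "trace (matrix L) = (\<Sum>j\<in>UNIV. \<Sum>a\<in>UNIV. e a $ j * b (e a) (L (axis j 1)))"
    by (simp add: trace_def matrix_def)
  also have "\<dots> = (\<Sum>a\<in>UNIV. b (e a) (L (e a)))"
    by (subst sum.swap) (simp add: L[of _ "e _"])
  finally show ?thesis .
qed

end

end

subsection \<open>Levi-Civita connection and isometric maps\<close>

locale metric_domain =
  fixes U :: "(real^'m) set" and G :: "(real^'m) metric"
  assumes open_dom: "open U"
    and smooth_metric: "smooth_on U (\<lambda>x. G x u v)"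
    and bilinear_metric: "x \<in> U \<Longrightarrow> bilinear (G x)"
    and metric_sym: "x \<in> U \<Longrightarrow> G x u v = G x v u"
    and metric_pos: "x \<in> U \<Longrightarrow> u \<noteq> 0 \<Longrightarrow> G x u u > 0"
begin

lemma inner_form_at: "x \<in> U \<Longrightarrow> inner_form (G x)"
  by (simp add: inner_form_def bilinear_metric metric_sym metric_pos)

lemmas metric_ops = inner_form.ops[OF inner_form_at]
lemmas metric_eqI = inner_form.nondegenerate[OF inner_form_at]

lemma metric_differentiable: "x \<in> U \<Longrightarrow> (\<lambda>y. G y u v) differentiable (at x)"
  by (rule smooth_on_differentiable[OF smooth_metric])

lemma fderiv_metric_sym: "x \<in> U \<Longrightarrow> fderiv (\<lambda>y. G y u v) x w = fderiv (\<lambda>y. G y v u) x w"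
  by (rule fderiv_cong_open[OF open_dom]) (auto simp: metric_sym)

lemma linear_fderiv_metric:
  assumes "x \<in> U"
  shows "linear (fderiv (\<lambda>y. G y u v) x)"
    and "linear (\<lambda>v. fderiv (\<lambda>y. G y u v) x w)"
    and "linear (\<lambda>u. fderiv (\<lambda>y. G y u v) x w)"
proof -
  show "linear (fderiv (\<lambda>y. G y u v) x)"
    by (rule linear_fderiv[OF metric_differentiable[OF assms]])
  show "linear (\<lambda>v. fderiv (\<lambda>y. G y u v) x w)" for u
    by (rule linear_fderiv_family[where L = "\<lambda>y. G y u", OF open_dom assms inner_form.linear_right[OF inner_form_at]
          metric_differentiable[OF assms]])
  from this[of v] show "linear (\<lambda>u. fderiv (\<lambda>y. G y u v) x w)"
    by (simp only: fderiv_metric_sym[OF assms, of v])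
qed

lemmas fderiv_metric_ops =
  linear_add[OF linear_fderiv_metric(1)] linear_scale[OF linear_fderiv_metric(1)]
  linear_add[OF linear_fderiv_metric(2)] linear_scale[OF linear_fderiv_metric(2)]
  linear_add[OF linear_fderiv_metric(3)] linear_scale[OF linear_fderiv_metric(3)]

lemma linear_koszul:
  assumes "x \<in> U"
  shows "linear (\<lambda>z. (fderiv (\<lambda>y. G y v z) x u + fderiv (\<lambda>y. G y u z) x v
    - fderiv (\<lambda>y. G y u v) x z) / 2)"
  by (rule linearI) (simp_all add: fderiv_metric_ops[OF assms] field_simps)

lemma smooth_sharp:
  assumes "\<And>y. y \<in> U \<Longrightarrow> linear (\<alpha> y)" "\<And>z. smooth_on U (\<lambda>y. \<alpha> y z)"
  shows "smooth_on U (\<lambda>y. sharp (G y) (\<alpha> y))"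
proof (rule smooth_on_cong[OF open_dom])
  have "smooth_on U (\<lambda>y. if j = k then \<alpha> y (axis i 1) else G y (axis i 1) (axis j 1))"
    for i j k :: 'm
    using assms smooth_metric by (cases "j = k") auto
  then show "smooth_on U (\<lambda>y. \<chi> k. det (\<chi> i j. if j = k then \<alpha> y (axis i 1) else G y (axis i 1) (axis j 1))
      * inverse (det (\<chi> k l. G y (axis k 1) (axis l 1))))"
    by (intro smooth_on_vec_lambda smooth_on_mult smooth_on_inverse smooth_on_det open_dom smooth_metric
        inner_form.gram_det_nonzero inner_form_at)
qed (simp add: inner_form.sharp_cramer[OF inner_form_at assms(1)] divide_inverse)

lemma christoffel_eq:
  "x \<in> U \<Longrightarrow> G x (christoffel G x u v) z = (fderiv (\<lambda>y. G y v z) x u + fderiv (\<lambda>y. G y u z) x v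
    - fderiv (\<lambda>y. G y u v) x z) / 2"
  unfolding christoffel_def by (rule inner_form.sharp_works[OF inner_form_at linear_koszul])

lemma christoffel_sym: "x \<in> U \<Longrightarrow> christoffel G x u v = christoffel G x v u"
  by (rule metric_eqI) (auto simp: christoffel_eq fderiv_metric_sym[of x u v])

text \<open>Metric compatibility of the Levi-Civita connection: in the sum of the two Koszul
  formulas all terms cancel except two equal halves.\<close>

lemma fderiv_metric:
  assumes "x \<in> U"
  shows "fderiv (\<lambda>y. G y v w) x u = G x (christoffel G x u v) w + G x v (christoffel G x u w)"
  using fderiv_metric_sym[OF assms, of v w]
  by (simp add: metric_sym[OF assms, of v] christoffel_eq[OF assms] field_simps)

lemma linear_christoffel:
  assumes "x \<in> U"
  shows "linear (christoffel G x u)" and "linear (\<lambda>u. christoffel G x u v)"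
proof -
  show "linear (christoffel G x u)" for u
    by (rule linearI; rule metric_eqI[OF assms])
      (simp_all add: metric_ops[OF assms] christoffel_eq[OF assms] fderiv_metric_ops[OF assms] field_simps)
  moreover have "(\<lambda>u. christoffel G x u v) = christoffel G x v"
    using christoffel_sym[OF assms] by blast
  ultimately show "linear (\<lambda>u. christoffel G x u v)" by simp
qed

lemma bilinear_christoffel: "x \<in> U \<Longrightarrow> bilinear (christoffel G x)"
  by (simp add: bilinear_def linear_christoffel)

lemma smooth_christoffel: "smooth_on U (\<lambda>y. christoffel G y u v)"
  unfolding christoffel_def
proof (rule smooth_sharp[OF linear_koszul])
  show "smooth_on U (\<lambda>x. (fderiv (\<lambda>y. G y v z) x u + fderiv (\<lambda>y. G y u z) x v
      - fderiv (\<lambda>y. G y u v) x z) / 2)" for z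
    unfolding divide_inverse
    by (intro smooth_on_mult smooth_on_diff smooth_on_add smooth_on_fderiv smooth_metric open_dom
        smooth_on_const)
qed

end

text \<open>The dimensions may differ, so the same calculus serves three kinds of maps: the
  immersion, the transition maps, and the identity of a metric domain.\<close>

locale isometric_map = src: metric_domain U G + tgt: metric_domain V H
  for U :: "(real^'m) set" and G and V :: "(real^'n) set" and H +
  fixes F :: "real^'m \<Rightarrow> real^'n"
  assumes smooth_map: "smooth_on U F"
    and maps_to: "x \<in> U \<Longrightarrow> F x \<in> V"
    and isometric: "x \<in> U \<Longrightarrow> G x u v = H (F x) (fderiv F x u) (fderiv F x v)"
begin

abbreviation nabla :: "(real^'m \<Rightarrow> real^'n) \<Rightarrow> real^'m \<Rightarrow> real^'m \<Rightarrow> real^'n" where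
  "nabla \<equiv> cov_deriv H F"

lemma map_differentiable: "x \<in> U \<Longrightarrow> F differentiable (at x)"
  by (rule smooth_on_differentiable[OF smooth_map])

lemma dmap_differentiable: "x \<in> U \<Longrightarrow> (\<lambda>y. fderiv F y v) differentiable (at x)"
  by (rule smooth_on_differentiable[OF smooth_on_fderiv[OF smooth_map]])

lemma linear_dmap: "x \<in> U \<Longrightarrow> linear (fderiv F x)"
  by (rule linear_fderiv[OF map_differentiable])

lemma inj_dmap: "x \<in> U \<Longrightarrow> fderiv F x u = fderiv F x v \<Longrightarrow> u = v"
  using isometric by (auto intro!: src.metric_eqI)

lemma smooth_pullback:
  fixes f :: "real^'n \<Rightarrow> 'c::real_normed_vector"
  shows "smooth_on V f \<Longrightarrow> smooth_on U (\<lambda>y. f (F y))"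
  by (rule smooth_on_compose[OF src.open_dom maps_to _ smooth_map])

lemma smooth_pullback_metric: "smooth_on U (\<lambda>y. H (F y) u v)"
  by (rule smooth_pullback[OF tgt.smooth_metric])

lemma smooth_pullback_christoffel: "smooth_on U (\<lambda>y. christoffel H (F y) u v)"
  by (rule smooth_pullback[OF tgt.smooth_christoffel])

lemma smooth_metric_along:
  "smooth_on U X \<Longrightarrow> smooth_on U Y \<Longrightarrow> smooth_on U (\<lambda>y. H (F y) (X y) (Y y))"
  by (rule smooth_on_bilinear_family[OF src.open_dom tgt.bilinear_metric[OF maps_to]
        smooth_pullback_metric])

text \<open>The chain rule carries metric compatibility of the target over to fields along
  \<open>F\<close>.\<close>

lemma fderiv_metric_along:
  assumes x: "x \<in> U" and X: "X differentiable (at x)" and Y: "Y differentiable (at x)"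
  shows "fderiv (\<lambda>y. H (F y) (X y) (Y y)) x u
    = H (F x) (nabla X x u) (Y x) + H (F x) (X x) (nabla Y x u)"
proof -
  have "fderiv (\<lambda>y. H (F y) (X y) (Y y)) x u = fderiv (\<lambda>y. H (F y) (X x) (Y x)) x u
      + H (F x) (fderiv X x u) (Y x) + H (F x) (X x) (fderiv Y x u)"
    by (rule fderiv_bilinear_family[where B = "\<lambda>y. H (F y)",
          OF src.open_dom x tgt.bilinear_metric[OF maps_to]
          smooth_on_differentiable[OF smooth_pullback_metric x] X Y])
  also have "fderiv (\<lambda>y. H (F y) (X x) (Y x)) x u
      = fderiv (\<lambda>z. H z (X x) (Y x)) (F x) (fderiv F x u)"
    by (rule fderiv_compose[OF map_differentiable[OF x] tgt.metric_differentiable[OF maps_to[OF x]]])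
  finally show ?thesis
    by (simp add: tgt.fderiv_metric[OF maps_to[OF x]] cov_deriv_def tgt.metric_ops[OF maps_to[OF x]])
qed

lemma smooth_nabla: "smooth_on U X \<Longrightarrow> smooth_on U (\<lambda>y. nabla X y u)"
  unfolding cov_deriv_def
  by (intro smooth_on_add src.open_dom smooth_on_fderiv smooth_map
      smooth_on_bilinear_family[where B = "\<lambda>y. christoffel H (F y)", OF src.open_dom
        tgt.bilinear_christoffel[OF maps_to] smooth_pullback_christoffel])

lemma nabla_cong:
  assumes "x \<in> U" "\<And>y. y \<in> U \<Longrightarrow> X y = Y y"
  shows "nabla X x u = nabla Y x u"
  using fderiv_cong_open[OF src.open_dom assms(1), of X Y] assms by (simp add: cov_deriv_def)

lemma nabla_add:
  assumes "x \<in> U" "X differentiable (at x)" "Y differentiable (at x)"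
  shows "nabla (\<lambda>y. X y + Y y) x u = nabla X x u + nabla Y x u"
  using fderiv_eq[OF has_derivative_add[OF fderiv_works fderiv_works, OF assms(2,3)]]
    linear_add[OF tgt.linear_christoffel(1)[OF maps_to[OF assms(1)]]]
  by (simp add: cov_deriv_def)

lemma nabla_scaleR:
  assumes "x \<in> U" "f differentiable (at x)" "X differentiable (at x)"
  shows "nabla (\<lambda>y. f y *\<^sub>R X y) x u = fderiv f x u *\<^sub>R X x + f x *\<^sub>R nabla X x u"
  using fderiv_eq[OF has_derivative_scaleR[OF fderiv_works fderiv_works, OF assms(2,3)]]
    linear_scale[OF tgt.linear_christoffel(1)[OF maps_to[OF assms(1)]]]
  by (simp add: cov_deriv_def algebra_simps)

lemma nabla_tangent:
  assumes "x \<in> U" "W differentiable (at x)"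
  shows "nabla (\<lambda>y. fderiv F y (W y)) x u
    = fderiv F x (fderiv W x u) + nabla (\<lambda>y. fderiv F y (W x)) x u"
  using fderiv_linear_family[where L = "fderiv F", OF src.open_dom assms(1) linear_dmap
      dmap_differentiable[OF assms(1)] assms(2)]
  by (simp add: cov_deriv_def)

text \<open>Second derivatives of \<open>F\<close> commute and the connection of the target has no
  torsion.\<close>

lemma nabla_dmap_sym:
  "x \<in> U \<Longrightarrow> nabla (\<lambda>y. fderiv F y v) x u = nabla (\<lambda>y. fderiv F y u) x v"
  using fderiv_commute[OF src.open_dom smooth_map] tgt.christoffel_sym[OF maps_to]
  by (simp add: cov_deriv_def)

text \<open>Both sides satisfy the Koszul formula.\<close>

lemma nabla_dmap_tangential:
  assumes x: "x \<in> U"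
  shows "H (F x) (nabla (\<lambda>y. fderiv F y v) x u) (fderiv F x z) = G x (christoffel G x u v) z"
proof -
  have "fderiv (\<lambda>y. G y v w) x u = H (F x) (nabla (\<lambda>y. fderiv F y v) x u) (fderiv F x w)
      + H (F x) (nabla (\<lambda>y. fderiv F y w) x u) (fderiv F x v)" for u v w
  proof -
    have "fderiv (\<lambda>y. G y v w) x u = fderiv (\<lambda>y. H (F y) (fderiv F y v) (fderiv F y w)) x u"
      by (rule fderiv_cong_open[OF src.open_dom x isometric])
    then show ?thesis
      using fderiv_metric_along[OF x dmap_differentiable[OF x] dmap_differentiable[OF x]]
        tgt.metric_sym[OF maps_to[OF x]] by simp
  qed
  then show ?thesis
    using nabla_dmap_sym[OF x, of u v] nabla_dmap_sym[OF x, of z u] nabla_dmap_sym[OF x, of z v]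
    by (simp add: src.christoffel_eq[OF x])
qed

text \<open>Ricci identity for the pulled-back connection. The directions are constant fields, so
  the second derivatives of \<open>X\<close> and \<open>F\<close> and the mixed first-order terms
  are symmetric in \<open>u\<close> and \<open>v\<close> and drop out; what remains is the
  definition of \<open>curvature\<close> with arguments pushed forward by \<open>F\<close>.\<close>

lemma nabla_commutator:
  assumes x: "x \<in> U" and X: "smooth_on U X"
  shows "nabla (\<lambda>y. nabla X y v) x u - nabla (\<lambda>y. nabla X y u) x v
    = curvature H (F x) (fderiv F x u) (fderiv F x v) (X x)"
proof -
  note Fx = maps_to[OF x]
  note dX = smooth_on_differentiable[OF X x]
  have ddX: "(\<lambda>y. fderiv X y v) differentiable (at x)" for v
    by (rule smooth_on_differentiable[OF smooth_on_fderiv[OF X] x])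
  have dC: "(\<lambda>y. christoffel H (F y) a b) differentiable (at x)" for a b
    by (rule smooth_on_differentiable[OF smooth_pullback_christoffel x])
  note bil = tgt.bilinear_christoffel[OF maps_to]
  have fam: "((\<lambda>y. christoffel H (F y) (fderiv F y v) (X y)) has_derivative
      (\<lambda>u. fderiv (\<lambda>y. christoffel H (F y) (fderiv F x v) (X x)) x u
      + christoffel H (F x) (fderiv (\<lambda>y. fderiv F y v) x u) (X x)
      + christoffel H (F x) (fderiv F x v) (fderiv X x u))) (at x)" for v
    by (rule has_derivative_bilinear_family[where B = "\<lambda>y. christoffel H (F y)",
          OF src.open_dom x bil dC dmap_differentiable[OF x] dX])
  have comp: "fderiv (\<lambda>y. christoffel H (F y) a b) x u
      = fderiv (\<lambda>z. christoffel H z a b) (F x) (fderiv F x u)" for a b u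
    by (rule fderiv_compose[OF map_differentiable[OF x]
          smooth_on_differentiable[OF tgt.smooth_christoffel Fx]])
  have D: "fderiv (\<lambda>y. nabla X y v) x u = fderiv (\<lambda>y. fderiv X y v) x u
      + (fderiv (\<lambda>z. christoffel H z (fderiv F x v) (X x)) (F x) (fderiv F x u)
      + christoffel H (F x) (fderiv (\<lambda>y. fderiv F y v) x u) (X x)
      + christoffel H (F x) (fderiv F x v) (fderiv X x u))" for u v
    unfolding cov_deriv_def
    using fderiv_eq[OF has_derivative_add[OF fderiv_works[OF ddX] fam]] comp by simp
  show ?thesis
    unfolding cov_deriv_def[of H F "\<lambda>y. nabla X y _"] D curvature_def
    unfolding cov_deriv_def
    using fderiv_commute[OF src.open_dom X x, of v u]
      fderiv_commute[OF src.open_dom smooth_map x, of v u]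
    by (simp add: linear_add[OF tgt.linear_christoffel(1)[OF Fx]])
qed

end

text \<open>For the identity, \<open>cov_deriv\<close> is the Levi-Civita connection of
  \<open>G\<close> itself, so product rule and Ricci identity along maps also serve fields on the
  domain.\<close>

lemma (in metric_domain) isometric_map_id: "isometric_map U G U G (\<lambda>x. x)"
  by unfold_locales (simp_all add: smooth_on_id)

subsection \<open>Curvature tensor\<close>

text \<open>Sectional curvatures determine a curvature tensor. Polarizing in the outer and then in
  the inner pair of slots makes \<open>T\<close> alternate in neighbouring slots; then the three
  Bianchi terms are equal and their sum is \<open>3 * T u v w z\<close>. It will be applied to the
  difference between a curvature tensor and its constant curvature model.\<close>

lemma curvature_like_eq_zero:
  fixes T :: "'a::ab_group_add \<Rightarrow> 'a \<Rightarrow> 'a \<Rightarrow> 'a \<Rightarrow> real"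
  assumes add: "\<And>u u' v w z. T (u + u') v w z = T u v w z + T u' v w z"
      "\<And>u v v' w z. T u (v + v') w z = T u v w z + T u v' w z"
      "\<And>u v w w' z. T u v (w + w') z = T u v w z + T u v w' z"
      "\<And>u v w z z'. T u v w (z + z') = T u v w z + T u v w z'"
    and skew: "\<And>u v w z. T v u w z = - T u v w z" "\<And>u v w z. T u v z w = - T u v w z"
    and bianchi: "\<And>u v w z. T u v w z + T v w u z + T w u v z = 0"
    and sec: "\<And>u v. T u v v u = 0"
  shows "T u v w z = 0"
proof -
  \<comment> \<open>The classical pair symmetry, a combination of four instances of the Bianchi
    identity with the two skew symmetries.\<close>
  have pair: "T u v w z = T w z u v" for u v w z
  proof -
    have "T v z u w = T v w u z + T w z u v"
      using bianchi[of v w z u] skew(2)[of v w z u] skew(2)[of w z u v]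
        skew(1)[of v z w u] skew(2)[of v z u w] by linarith
    moreover have "T w z u v + T z u w v + T w u v z = 0"
      using bianchi[of w z u v] skew(1)[of w u z v] skew(2)[of w u v z] by linarith
    moreover have "T v z u w = T z u w v + T u v w z"
      using bianchi[of z u v w] skew(2)[of z u w v] skew(2)[of u v w z] by linarith
    ultimately show ?thesis
      using bianchi[of u v w z] by linarith
  qed
  \<comment> \<open>Polarization in the outer slots: by pair symmetry the two cross terms are equal,
    so each vanishes.\<close>
  have 1: "T u v v z = 0" for u v z
  proof -
    have "T (u + z) v v (u + z) = T u v v u + T u v v z + T z v v u + T z v v z"
      by (simp add: add)
    moreover have "T z v v u = T u v v z"
      using pair[of z v v u] skew(1)[of v u z v] skew(2)[of u v v z] by linarith
    ultimately show ?thesis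
      using sec[of "u + z" v] sec[of u v] sec[of z v] by linarith
  qed
  have 2: "T u w v z = - T u v w z" for u v w z
    using 1[of u "v + w" z] 1[of u v z] 1[of u w z] add by simp
  show ?thesis
    using bianchi[of u v w z] 2[of v w u z] 2[of u v w z] skew(1)[of u v w z] skew(1)[of u w v z]
    by linarith
qed

context metric_domain
begin

lemma christoffel_differentiable: "x \<in> U \<Longrightarrow> (\<lambda>y. christoffel G y u v) differentiable (at x)"
  by (rule smooth_on_differentiable[OF smooth_christoffel])

lemma linear_fderiv_christoffel:
  assumes "x \<in> U"
  shows "linear (fderiv (\<lambda>y. christoffel G y u v) x)"
    and "linear (\<lambda>v. fderiv (\<lambda>y. christoffel G y u v) x w)"
    and "linear (\<lambda>u. fderiv (\<lambda>y. christoffel G y u v) x w)"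
  using linear_fderiv_family[where L = "\<lambda>y. christoffel G y u", OF open_dom assms
      linear_christoffel(1) christoffel_differentiable[OF assms]]
    linear_fderiv_family[where L = "\<lambda>y u. christoffel G y u v", OF open_dom assms
      linear_christoffel(2) christoffel_differentiable[OF assms]]
    linear_fderiv[OF christoffel_differentiable[OF assms]]
  by auto

lemma linear_curvature:
  assumes "x \<in> U"
  shows "linear (curvature G x u v)" and "linear (\<lambda>u. curvature G x u v w)"
    and "linear (\<lambda>v. curvature G x u v w)"
  unfolding curvature_def
  by (rule linearI; simp add: linear_add[OF linear_christoffel(1)[OF assms]]
      linear_scale[OF linear_christoffel(1)[OF assms]]
      linear_add[OF linear_christoffel(2)[OF assms]]
      linear_scale[OF linear_christoffel(2)[OF assms]]
      linear_add[OF linear_fderiv_christoffel(1)[OF assms]]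
      linear_scale[OF linear_fderiv_christoffel(1)[OF assms]]
      linear_add[OF linear_fderiv_christoffel(2)[OF assms]]
      linear_scale[OF linear_fderiv_christoffel(2)[OF assms]]
      linear_add[OF linear_fderiv_christoffel(3)[OF assms]]
      linear_scale[OF linear_fderiv_christoffel(3)[OF assms]] algebra_simps)+

lemma curvature_skew: "curvature G x v u w = - curvature G x u v w"
  by (simp add: curvature_def)

lemma curvature_bianchi:
  assumes "x \<in> U"
  shows "curvature G x u v w + curvature G x v w u + curvature G x w u v = 0"
proof -
  have "fderiv (\<lambda>y. christoffel G y a b) x d = fderiv (\<lambda>y. christoffel G y b a) x d" for a b d
    by (rule fderiv_cong_open[OF open_dom assms christoffel_sym])
  from this[of u v] this[of u w] this[of v w] show ?thesis
    using christoffel_sym[OF assms, of u v] christoffel_sym[OF assms, of u w]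
      christoffel_sym[OF assms, of v w] by (simp add: curvature_def)
qed

text \<open>This expresses that the second derivatives of \<open>G w w\<close> commute.\<close>

lemma curvature_metric_skew_diag:
  assumes x: "x \<in> U"
  shows "G x (curvature G x u v w) w = 0"
proof -
  interpret i: isometric_map U G U G "\<lambda>x. x" by (rule isometric_map_id)
  let ?W = "\<lambda>_. w"
  note W = smooth_on_const[of U w]
  have D: "fderiv (\<lambda>y. G y w w) y v = 2 * G y (i.nabla ?W y v) w" if "y \<in> U" for y v
    using i.fderiv_metric_along[OF that, of ?W ?W v] metric_sym[OF that, of w]
    by simp
  have DD: "fderiv (\<lambda>y. fderiv (\<lambda>y. G y w w) y v) x u
      = 2 * (G x (i.nabla (\<lambda>y. i.nabla ?W y v) x u) w + G x (i.nabla ?W x v) (i.nabla ?W x u))" for u v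
  proof -
    have dn: "(\<lambda>y. i.nabla ?W y v) differentiable (at x)"
      by (rule smooth_on_differentiable[OF i.smooth_nabla[OF W] x])
    have "fderiv (\<lambda>y. fderiv (\<lambda>y. G y w w) y v) x u = fderiv (\<lambda>y. 2 * G y (i.nabla ?W y v) w) x u"
      by (rule fderiv_cong_open[OF open_dom x D])
    also have "\<dots> = 2 * fderiv (\<lambda>y. G y (i.nabla ?W y v) w) x u"
      by (rule fderiv_bounded_linear[OF bounded_linear_mult_right
            smooth_on_differentiable[OF i.smooth_metric_along[OF i.smooth_nabla[OF W] W] x]])
    also have "fderiv (\<lambda>y. G y (i.nabla ?W y v) w) x u
        = G x (i.nabla (\<lambda>y. i.nabla ?W y v) x u) w + G x (i.nabla ?W x v) (i.nabla ?W x u)"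
      by (rule i.fderiv_metric_along[OF x dn differentiable_const])
    finally show ?thesis .
  qed
  have "fderiv (\<lambda>y. fderiv (\<lambda>y. G y w w) y v) x u = fderiv (\<lambda>y. fderiv (\<lambda>y. G y w w) y u) x v"
    by (rule fderiv_commute[OF open_dom smooth_metric x])
  then have "G x (i.nabla (\<lambda>y. i.nabla ?W y v) x u - i.nabla (\<lambda>y. i.nabla ?W y u) x v) w = 0"
    unfolding DD using metric_sym[OF x, of "i.nabla ?W x u"] by (simp add: metric_ops[OF x])
  then show ?thesis
    using i.nabla_commutator[OF x W, of v u] by simp
qed

lemma curvature_metric_skew:
  assumes x: "x \<in> U"
  shows "G x (curvature G x u v z) w = - G x (curvature G x u v w) z"
  using curvature_metric_skew_diag[OF x, of u v "w + z"] curvature_metric_skew_diag[OF x, of u v w]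
    curvature_metric_skew_diag[OF x, of u v z]
  by (simp add: metric_ops[OF x] linear_add[OF linear_curvature(1)[OF x]])

text \<open>Fills the gap left by hypotheses on independent pairs, so that statements about
  sectional curvature extend to all \<open>u\<close> and \<open>v\<close> once denominators are
  cleared. The clause \<open>u \<noteq> v\<close> matters because \<open>{u, u}\<close> is a
  singleton, which may be independent.\<close>

lemma curvature_degenerate:
  assumes x: "x \<in> U" and dep: "\<not> (u \<noteq> v \<and> independent {u, v})"
  shows "G x (curvature G x u v v) u = 0" and "G x u u * G x v v - (G x u v)\<^sup>2 = 0"
proof -
  have self: "curvature G x w w z = 0" for w z
    by (simp add: curvature_def)
  have "v = 0 \<or> (\<exists>k. u = k *\<^sub>R v)"
  proof (cases "u = v \<or> v = 0")
    case True
    then show ?thesis by (metis scaleR_one)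
  next
    case False
    then have "u \<in> span {v}"
      using dep by (auto simp: independent_insert)
    then show ?thesis by (auto simp: span_singleton)
  qed
  then show "G x (curvature G x u v v) u = 0" "G x u u * G x v v - (G x u v)\<^sup>2 = 0"
    using linear_0[OF linear_curvature(1)[OF x]] linear_scale[OF linear_curvature(2)[OF x]]
    by (auto simp: metric_ops[OF x] self power2_eq_square)
qed

lemma curvature_nonneg:
  assumes x: "x \<in> U"
    and K: "\<And>u v. u \<noteq> v \<Longrightarrow> independent {u, v} \<Longrightarrow> sectional_curvature G x u v \<ge> 0"
  shows "G x (curvature G x u v v) u \<ge> 0"
proof (cases "u \<noteq> v \<and> independent {u, v}")
  case True
  then have "G x u u * G x v v - (G x u v)\<^sup>2 > 0"
    by (intro inner_form.cauchy_schwarz_strict inner_form_at x) auto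
  with K[of u v] True show ?thesis
    by (simp add: sectional_curvature_def zero_le_divide_iff)
next
  case False
  then show ?thesis using curvature_degenerate[OF x] by simp
qed

text \<open>The right side has all symmetries of a curvature tensor and the prescribed value on
  every pair, so the difference falls under \<open>curvature_like_eq_zero\<close>.\<close>

lemma constant_curvature:
  assumes x: "x \<in> U"
    and K: "\<And>u v. u \<noteq> v \<Longrightarrow> independent {u, v} \<Longrightarrow> sectional_curvature G x u v = c"
  shows "G x (curvature G x u v w) z = c * (G x v w * G x u z - G x u w * G x v z)"
proof -
  note ops = metric_ops[OF x] linear_add[OF linear_curvature(1)[OF x]]
    linear_add[OF linear_curvature(2)[OF x]] linear_add[OF linear_curvature(3)[OF x]]
  note sym = metric_sym[OF x]
  have sec: "G x (curvature G x u v v) u = c * (G x u u * G x v v - (G x u v)\<^sup>2)" for u v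
  proof (cases "u \<noteq> v \<and> independent {u, v}")
    case True
    then have "G x u u * G x v v - (G x u v)\<^sup>2 > 0"
      by (intro inner_form.cauchy_schwarz_strict inner_form_at x) auto
    with K[of u v] True show ?thesis
      by (simp add: sectional_curvature_def field_simps)
  next
    case False
    then show ?thesis using curvature_degenerate[OF x] by simp
  qed
  have "G x (curvature G x u v w) z - c * (G x v w * G x u z - G x u w * G x v z) = 0"
  proof (rule curvature_like_eq_zero[where T = "\<lambda>u v w z. G x (curvature G x u v w) z
      - c * (G x v w * G x u z - G x u w * G x v z)"])
    fix u v w z
    show "G x (curvature G x v u w) z - c * (G x u w * G x v z - G x v w * G x u z)
      = - (G x (curvature G x u v w) z - c * (G x v w * G x u z - G x u w * G x v z))"
      by (simp add: curvature_skew[of x v u] ops algebra_simps)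
    show "G x (curvature G x u v z) w - c * (G x v z * G x u w - G x u z * G x v w)
      = - (G x (curvature G x u v w) z - c * (G x v w * G x u z - G x u w * G x v z))"
      using curvature_metric_skew[OF x, of u v z w] by (simp add: algebra_simps)
    have "G x (curvature G x u v w + curvature G x v w u + curvature G x w u v) z = 0"
      by (simp add: curvature_bianchi[OF x] ops)
    then show "G x (curvature G x u v w) z - c * (G x v w * G x u z - G x u w * G x v z)
      + (G x (curvature G x v w u) z - c * (G x w u * G x v z - G x v u * G x w z))
      + (G x (curvature G x w u v) z - c * (G x u v * G x w z - G x w v * G x u z)) = 0"
      by (simp add: ops sym[of w u] sym[of v u] sym[of w v] algebra_simps)
    show "G x (curvature G x u v v) u - c * (G x v v * G x u u - G x u v * G x v u) = 0"
      using sec[of u v] sym[of v u] by (simp add: power2_eq_square algebra_simps)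
  qed (simp_all add: ops algebra_simps)
  then show ?thesis by simp
qed

end

subsection \<open>Local geometry of hypersurfaces\<close>

lemma trace_matrix: "trace (matrix L) = (\<Sum>k\<in>UNIV. L (axis k 1) $ k)"
  by (simp add: trace_def matrix_def)

lemma trace_matrix_comm:
  fixes L M :: "real^'m \<Rightarrow> real^'m"
  assumes "linear L" "linear M"
  shows "trace (matrix (\<lambda>v. L (M v))) = trace (matrix (\<lambda>v. M (L v)))"
  using matrix_compose[OF assms] matrix_compose[OF assms(2,1)] trace_mul_sym[of "matrix L"]
  by (simp add: comp_def)

lemma linear_metric_trace:
  assumes "linear f"
  shows "f (metric_trace b B) = metric_trace b (\<lambda>u v. f (B u v))"
  by (simp add: metric_trace_def linear_sum[OF assms] linear_scale[OF assms])

locale hypersurface = isometric_map U G V H F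
  for U :: "(real^'m) set" and G and V :: "(real^'n) set" and H F +
  fixes \<eta> :: "real^'m \<Rightarrow> real^'n" and c :: real
  assumes codim: "CARD('n) = CARD('m) + 1"
    and smooth_normal: "smooth_on U \<eta>"
    and unit_normal: "x \<in> U \<Longrightarrow> H (F x) (\<eta> x) (\<eta> x) = 1"
    and normal: "x \<in> U \<Longrightarrow> H (F x) (\<eta> x) (fderiv F x u) = 0"
    and target_curvature: "y \<in> V \<Longrightarrow> a \<noteq> b \<Longrightarrow> independent {a, b} \<Longrightarrow> sectional_curvature H y a b = c"
begin

abbreviation A :: "real^'m \<Rightarrow> real^'m \<Rightarrow> real^'m" where
  "A \<equiv> shape_operator G H F \<eta>"

abbreviation \<Gamma> :: "real^'m \<Rightarrow> real^'m \<Rightarrow> real^'m \<Rightarrow> real^'m" where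
  "\<Gamma> \<equiv> christoffel G"

lemmas tgt_ops = tgt.metric_ops[OF maps_to]
lemmas dmap_ops = linear_add[OF linear_dmap] linear_scale[OF linear_dmap]
  linear_neg[OF linear_dmap] linear_diff[OF linear_dmap]

lemma normal_differentiable: "x \<in> U \<Longrightarrow> \<eta> differentiable (at x)"
  by (rule smooth_on_differentiable[OF smooth_normal])

lemma normal': "x \<in> U \<Longrightarrow> H (F x) (fderiv F x u) (\<eta> x) = 0"
  using normal tgt.metric_sym[OF maps_to] by metis

text \<open>By orthogonality the map sending \<open>(u, r)\<close> to
  \<open>fderiv F x u + r *\<^sub>R \<eta> x\<close> is injective, and \<open>codim\<close> makes
  both spaces of equal dimension, so it is onto. This is where codimension one enters.\<close>

lemma splitting:
  assumes x: "x \<in> U"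
  obtains u r where "w = fderiv F x u + r *\<^sub>R \<eta> x"
proof -
  define L where "L p = fderiv F x (fst p) + snd p *\<^sub>R \<eta> x" for p :: "(real^'m) \<times> real"
  have lin: "linear L"
    by (rule linearI) (simp_all add: L_def dmap_ops[OF x] algebra_simps)
  have "p = 0" if "L p = 0" for p
  proof -
    have "H (F x) (L p) (\<eta> x) = 0" "H (F x) (L p) (fderiv F x z) = 0" for z
      using that by (simp_all add: tgt_ops[OF x])
    then have "snd p = 0" "G x (fst p) z = G x 0 z" for z
      by (simp_all add: L_def tgt_ops[OF x] normal[OF x] normal'[OF x] unit_normal[OF x]
          isometric[OF x, symmetric] src.metric_ops[OF x])
    then show ?thesis using src.metric_eqI[OF x, of "fst p" 0] by (simp add: prod_eq_iff)
  qed
  then have "inj L" using linear_injective_0[OF lin] by blast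
  then have "surj L"
    by (intro linear_injective_imp_surjective[OF lin]) (simp_all add: codim)
  then obtain p where "w = L p" by (metis surjD)
  with that show ?thesis by (simp add: L_def)
qed

lemma splitting_eqI:
  assumes x: "x \<in> U" and "\<And>z. H (F x) X (fderiv F x z) = H (F x) Y (fderiv F x z)"
    and "H (F x) X (\<eta> x) = H (F x) Y (\<eta> x)"
  shows "X = Y"
proof (rule tgt.metric_eqI[OF maps_to[OF x]])
  fix w
  obtain u r where "w = fderiv F x u + r *\<^sub>R \<eta> x" by (rule splitting[OF x])
  then show "H (F x) X w = H (F x) Y w"
    using assms by (simp add: tgt_ops[OF x])
qed

lemma shape_eq:
  assumes x: "x \<in> U"
  shows "G x (A x u) z = - H (F x) (nabla \<eta> x u) (fderiv F x z)"
proof -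
  have "linear (\<lambda>w. H (F x) (cov_deriv H F \<eta> x u) (fderiv F x w))"
    by (rule linearI) (simp_all add: tgt_ops[OF x] dmap_ops[OF x])
  from inner_form.sharp_works[OF src.inner_form_at[OF x] this]
  show ?thesis
    by (simp add: shape_operator_def tangent_part_def src.metric_ops[OF x])
qed

text \<open>Weingarten formula. Differentiating \<open>H (F x) (\<eta> x) (\<eta> x) = 1\<close>
  shows that the derivative of the normal has no normal component.\<close>

lemma nabla_normal:
  assumes x: "x \<in> U"
  shows "nabla \<eta> x u = - fderiv F x (A x u)"
proof (rule splitting_eqI[OF x])
  have "fderiv (\<lambda>y. H (F y) (\<eta> y) (\<eta> y)) x u = 0"
    using fderiv_cong_open[OF src.open_dom x, of "\<lambda>y. H (F y) (\<eta> y) (\<eta> y)" "\<lambda>_. 1"] unit_normal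
    by simp
  then show "H (F x) (nabla \<eta> x u) (\<eta> x) = H (F x) (- fderiv F x (A x u)) (\<eta> x)"
    using fderiv_metric_along[OF x normal_differentiable[OF x] normal_differentiable[OF x], of u]
      tgt.metric_sym[OF maps_to[OF x], of "\<eta> x"]
    by (simp add: tgt_ops[OF x] normal'[OF x])
qed (simp add: tgt_ops[OF x] isometric[OF x, symmetric] shape_eq[OF x])

text \<open>Differentiate the orthogonality of \<open>fderiv F y v\<close> and
  \<open>\<eta> y\<close> and insert the Weingarten formula.\<close>

lemma second_fundamental_form:
  assumes x: "x \<in> U"
  shows "H (F x) (nabla (\<lambda>y. fderiv F y v) x u) (\<eta> x) = G x (A x u) v"
proof -
  have "fderiv (\<lambda>y. H (F y) (fderiv F y v) (\<eta> y)) x u = 0"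
    using fderiv_cong_open[OF src.open_dom x, of "\<lambda>y. H (F y) (fderiv F y v) (\<eta> y)" "\<lambda>_. 0"] normal'
    by simp
  then show ?thesis
    using fderiv_metric_along[OF x dmap_differentiable[OF x] normal_differentiable[OF x], of v u]
    by (simp add: nabla_normal[OF x] tgt_ops[OF x] isometric[OF x, symmetric]
        src.metric_sym[OF x, of v])
qed

lemma shape_self_adjoint: "x \<in> U \<Longrightarrow> G x (A x u) v = G x u (A x v)"
  using second_fundamental_form[of x u v] second_fundamental_form[of x v u] nabla_dmap_sym[of x u v]
    src.metric_sym[of x u] by simp

lemma linear_shape:
  assumes x: "x \<in> U"
  shows "linear (A x)"
  by (rule linearI; rule src.metric_eqI[OF x])
    (simp_all add: src.metric_ops[OF x] shape_self_adjoint[OF x])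

lemma smooth_shape: "smooth_on U (\<lambda>y. A y u)"
  unfolding shape_operator_def tangent_part_def
proof (rule smooth_on_minus[OF src.open_dom src.smooth_sharp])
  show "linear (\<lambda>w. H (F y) (nabla \<eta> y u) (fderiv F y w))" if "y \<in> U" for y
    by (rule linearI) (simp_all add: tgt_ops[OF that] dmap_ops[OF that])
  show "smooth_on U (\<lambda>y. H (F y) (nabla \<eta> y u) (fderiv F y z))" for z
    by (intro smooth_metric_along smooth_nabla smooth_normal smooth_on_fderiv smooth_map)
qed

lemma shape_differentiable: "x \<in> U \<Longrightarrow> (\<lambda>y. A y u) differentiable (at x)"
  by (rule smooth_on_differentiable[OF smooth_shape])

text \<open>Gauss formula: the tangential part comes from the Koszul formula, the normal part from
  the second fundamental form.\<close>

lemma nabla_dmap: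
  assumes x: "x \<in> U"
  shows "nabla (\<lambda>y. fderiv F y v) x u = fderiv F x (\<Gamma> x u v) + G x (A x u) v *\<^sub>R \<eta> x"
  by (rule splitting_eqI[OF x])
    (simp_all add: tgt_ops[OF x] isometric[OF x, symmetric] nabla_dmap_tangential[OF x]
      second_fundamental_form[OF x] normal[OF x] normal'[OF x] unit_normal[OF x])

lemma nabla_tangent_field:
  assumes x: "x \<in> U" and W: "W differentiable (at x)"
  shows "nabla (\<lambda>y. fderiv F y (W y)) x u
    = fderiv F x (fderiv W x u + \<Gamma> x u (W x)) + G x (A x u) (W x) *\<^sub>R \<eta> x"
  by (simp add: nabla_tangent[OF x W] nabla_dmap[OF x] dmap_ops[OF x])

lemma target_curvature_tensor:
  "x \<in> U \<Longrightarrow> H (F x) (curvature H (F x) u v w) z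
    = c * (H (F x) v w * H (F x) u z - H (F x) u w * H (F x) v z)"
  by (rule tgt.constant_curvature[OF maps_to target_curvature]) (auto intro: maps_to)

text \<open>The covariant derivative of the tensor \<open>A\<close> in direction \<open>u\<close>,
  applied to \<open>v\<close>; \<open>v\<close> is extended as a constant field, which explains the
  last term.\<close>

definition nabla_shape :: "real^'m \<Rightarrow> real^'m \<Rightarrow> real^'m \<Rightarrow> real^'m" where
  "nabla_shape x u v = fderiv (\<lambda>y. A y v) x u + \<Gamma> x u (A x v) - A x (\<Gamma> x u v)"

lemma linear_fderiv_shape: "x \<in> U \<Longrightarrow> linear (\<lambda>v. fderiv (\<lambda>y. A y v) x u)"
  by (rule linear_fderiv_family[where L = A, OF src.open_dom _ linear_shape shape_differentiable])

lemma bilinear_nabla_shape: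
  assumes x: "x \<in> U"
  shows "bilinear (nabla_shape x)"
  unfolding bilinear_def nabla_shape_def
  by (intro conjI allI linearI; simp add: 
      linear_add[OF linear_fderiv_shape[OF x]] linear_scale[OF linear_fderiv_shape[OF x]]
      linear_add[OF linear_fderiv[OF shape_differentiable[OF x]]]
      linear_scale[OF linear_fderiv[OF shape_differentiable[OF x]]]
      linear_add[OF linear_shape[OF x]] linear_scale[OF linear_shape[OF x]]
      linear_add[OF src.linear_christoffel(1)[OF x]] linear_scale[OF src.linear_christoffel(1)[OF x]]
      linear_add[OF src.linear_christoffel(2)[OF x]] linear_scale[OF src.linear_christoffel(2)[OF x]]
      algebra_simps)

text \<open>Ricci identity for the field \<open>\<eta>\<close>. In constant curvature the curvature
  term vanishes because \<open>\<eta>\<close> is orthogonal to both directions; the normal parts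
  \<open>G x (A x u) (A x v)\<close> cancel by symmetry, and injectivity of the differential
  compares the tangential parts.\<close>

lemma codazzi:
  assumes x: "x \<in> U"
  shows "nabla_shape x u v = nabla_shape x v u"
proof -
  have D: "nabla (\<lambda>y. nabla \<eta> y v) x u
      = - fderiv F x (fderiv (\<lambda>y. A y v) x u + \<Gamma> x u (A x v)) - G x (A x u) (A x v) *\<^sub>R \<eta> x" for u v
  proof -
    have "nabla (\<lambda>y. nabla \<eta> y v) x u = nabla (\<lambda>y. (- 1) *\<^sub>R fderiv F y (A y v)) x u"
      by (rule nabla_cong[OF x]) (simp add: nabla_normal)
    also have "\<dots> = - nabla (\<lambda>y. fderiv F y (A y v)) x u"
      using nabla_scaleR[OF x, of "\<lambda>_. - 1" "\<lambda>y. fderiv F y (A y v)" u]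
        smooth_on_differentiable[OF smooth_on_linear_family[OF src.open_dom linear_dmap
          smooth_on_fderiv[OF smooth_map] smooth_shape] x] by simp
    finally show ?thesis by (simp add: nabla_tangent_field[OF x shape_differentiable[OF x]])
  qed
  have "curvature H (F x) (fderiv F x u) (fderiv F x v) (\<eta> x) = 0"
    by (rule tgt.metric_eqI[OF maps_to[OF x]])
      (simp add: target_curvature_tensor[OF x] normal'[OF x] tgt_ops[OF x])
  with nabla_commutator[OF x smooth_normal, of v u]
  have "fderiv F x (fderiv (\<lambda>y. A y v) x u + \<Gamma> x u (A x v))
      = fderiv F x (fderiv (\<lambda>y. A y u) x v + \<Gamma> x v (A x u))"
    by (simp add: D src.metric_sym[OF x, of "A x u"])
  from inj_dmap[OF x this] show ?thesis
    by (simp add: nabla_shape_def src.christoffel_sym[OF x, of u v])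
qed

text \<open>Obtained by differentiating the symmetry of \<open>G y (A y v) w\<close> in
  \<open>v\<close> and \<open>w\<close>.\<close>

lemma nabla_shape_self_adjoint:
  assumes x: "x \<in> U"
  shows "G x (nabla_shape x u v) w = G x v (nabla_shape x u w)"
proof -
  interpret i: isometric_map U G U G "\<lambda>x. x" by (rule src.isometric_map_id)
  have D: "fderiv (\<lambda>y. G y (A y v) w) x u
      = G x (fderiv (\<lambda>y. A y v) x u + \<Gamma> x u (A x v)) w + G x (A x v) (\<Gamma> x u w)" for v w
    using i.fderiv_metric_along[OF x shape_differentiable[OF x] differentiable_const]
    by (simp add: cov_deriv_def)
  have "fderiv (\<lambda>y. G y (A y v) w) x u = fderiv (\<lambda>y. G y (A y w) v) x u"
    by (rule fderiv_cong_open[OF src.open_dom x]) (metis shape_self_adjoint src.metric_sym)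
  then show ?thesis
    unfolding D nabla_shape_def src.metric_sym[OF x, of v]
    by (simp add: src.metric_ops[OF x] shape_self_adjoint[OF x] src.metric_sym[OF x, of "\<Gamma> x u v"]
        src.metric_sym[OF x, of "\<Gamma> x u w"])
qed

text \<open>Ricci identity for the field \<open>fderiv F y w\<close>, paired with a tangent vector.
  The normal part of its first derivative becomes tangential when differentiated again by the
  Weingarten formula; this produces the terms quadratic in \<open>A\<close>.\<close>

lemma gauss_equation:
  assumes x: "x \<in> U"
  shows "G x (curvature G x u v w) z = c * (G x v w * G x u z - G x u w * G x v z)
    + G x (A x v) w * G x (A x u) z - G x (A x u) w * G x (A x v) z"
proof -
  have D: "H (F x) (nabla (\<lambda>y. nabla (\<lambda>y. fderiv F y w) y v) x u) (fderiv F x z)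
      = G x (fderiv (\<lambda>y. \<Gamma> y v w) x u + \<Gamma> x u (\<Gamma> x v w)) z - G x (A x v) w * G x (A x u) z" for u v
  proof -
    interpret i: isometric_map U G U G "\<lambda>x. x" by (rule src.isometric_map_id)
    have dG: "(\<lambda>y. G y (A y v) w) differentiable (at x)"
      by (rule smooth_on_differentiable[OF i.smooth_metric_along[OF smooth_shape smooth_on_const] x])
    have sF: "smooth_on U (\<lambda>y. fderiv F y (\<Gamma> y v w))"
      by (rule smooth_on_linear_family[OF src.open_dom linear_dmap smooth_on_fderiv[OF smooth_map]
            src.smooth_christoffel])
    have "nabla (\<lambda>y. nabla (\<lambda>y. fderiv F y w) y v) x u
        = nabla (\<lambda>y. fderiv F y (\<Gamma> y v w) + G y (A y v) w *\<^sub>R \<eta> y) x u"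
      by (rule nabla_cong[OF x nabla_dmap])
    also have "\<dots> = nabla (\<lambda>y. fderiv F y (\<Gamma> y v w)) x u + nabla (\<lambda>y. G y (A y v) w *\<^sub>R \<eta> y) x u"
      by (rule nabla_add[OF x smooth_on_differentiable[OF sF x]])
        (intro differentiable_scaleR dG normal_differentiable x)
    finally show ?thesis
      by (simp add: nabla_scaleR[OF x dG normal_differentiable[OF x]] nabla_normal[OF x]
          nabla_tangent_field[OF x src.christoffel_differentiable[OF x]] tgt_ops[OF x] normal[OF x]
          isometric[OF x, symmetric])
  qed
  have "H (F x) (curvature H (F x) (fderiv F x u) (fderiv F x v) (fderiv F x w)) (fderiv F x z)
      = c * (G x v w * G x u z - G x u w * G x v z)"
    by (simp add: target_curvature_tensor[OF x] isometric[OF x])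
  then show ?thesis
    unfolding nabla_commutator[OF x smooth_on_fderiv[OF smooth_map], symmetric]
    by (simp add: tgt_ops[OF x] D curvature_def src.metric_ops[OF x])
qed

section \<open>Trace of the shape operator, tension and bitension fields\<close>

abbreviation \<phi> :: "real^'m \<Rightarrow> real" where
  "\<phi> x \<equiv> trace (matrix (A x))"

lemma smooth_trace_shape: "smooth_on U \<phi>"
  unfolding trace_matrix
  by (intro smooth_on_sum src.open_dom smooth_on_bounded_linear[OF _ bounded_linear_vec_nth]
      smooth_shape)

lemma trace_differentiable: "x \<in> U \<Longrightarrow> \<phi> differentiable (at x)"
  by (rule smooth_on_differentiable[OF smooth_trace_shape])

text \<open>Ordinary and covariant derivative of \<open>A\<close> differ by the commutator of
  \<open>A x\<close> with \<open>\<Gamma> x u\<close>, whose trace is zero.\<close>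

lemma fderiv_trace_shape:
  assumes x: "x \<in> U"
  shows "fderiv \<phi> x u = trace (matrix (nabla_shape x u))"
proof -
  have "(\<phi> has_derivative (\<lambda>u. \<Sum>k\<in>UNIV. fderiv (\<lambda>y. A y (axis k 1)) x u $ k)) (at x)"
    unfolding trace_matrix
    by (intro has_derivative_sum bounded_linear.has_derivative[OF bounded_linear_vec_nth]
        fderiv_works shape_differentiable x)
  then have "fderiv \<phi> x u = (\<Sum>k\<in>UNIV. fderiv (\<lambda>y. A y (axis k 1)) x u $ k)"
    by (rule fderiv_eq)
  moreover have "(\<Sum>k\<in>UNIV. \<Gamma> x u (A x (axis k 1)) $ k) = (\<Sum>k\<in>UNIV. A x (\<Gamma> x u (axis k 1)) $ k)"
    using trace_matrix_comm[OF src.linear_christoffel(1)[OF x] linear_shape[OF x]]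
    by (simp add: trace_matrix)
  ultimately show ?thesis
    by (simp add: trace_matrix nabla_shape_def sum.distrib sum_subtractf)
qed

text \<open>Codazzi moves \<open>z\<close> from the direction of differentiation to the argument,
  self-adjointness then moves it to the other side of the metric; so the trace of
  \<open>nabla_shape x z\<close> becomes a divergence.\<close>

lemma divergence_shape:
  fixes e :: "'m \<Rightarrow> real^'m"
  assumes x: "x \<in> U" and e: "\<And>i j. G x (e i) (e j) = (if i = j then 1 else 0)"
  shows "(\<Sum>i\<in>UNIV. G x (nabla_shape x (e i) (e i)) z) = fderiv \<phi> x z"
proof -
  have "linear (nabla_shape x z)" using bilinear_nabla_shape[OF x] by (simp add: bilinear_def)
  then have "fderiv \<phi> x z = (\<Sum>i\<in>UNIV. G x (e i) (nabla_shape x z (e i)))"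
    by (simp add: fderiv_trace_shape[OF x]
        inner_form.trace_orthonormal[OF src.inner_form_at[OF x] e])
  also have "\<dots> = (\<Sum>i\<in>UNIV. G x (nabla_shape x (e i) (e i)) z)"
    by (simp add: nabla_shape_self_adjoint[OF x] codazzi[OF x, of z])
  finally show ?thesis by simp
qed

text \<open>The source Christoffel term in \<open>hessian_map\<close> cancels the tangential part of
  the Gauss formula. As \<open>\<phi>\<close> is the full trace, \<open>m\<close> times the mean
  curvature, no normalising factor appears.\<close>

lemma tension_eq:
  assumes x: "x \<in> U"
  shows "tension G H F x = \<phi> x *\<^sub>R \<eta> x"
proof -
  interpret b: inner_form "G x" by (rule src.inner_form_at[OF x])
  obtain e :: "'m \<Rightarrow> real^'m" where e: "\<And>i j. G x (e i) (e j) = (if i = j then 1 else 0)"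
    by (rule b.orthonormal_basis_exists) blast
  have "hessian_map G H F x = (\<lambda>u v. G x (A x u) v *\<^sub>R \<eta> x)"
    by (simp add: fun_eq_iff hessian_map_def nabla_dmap[OF x])
  moreover have "bilinear (\<lambda>u v. G x (A x u) v *\<^sub>R \<eta> x)"
    unfolding bilinear_def
    by (intro conjI allI linearI) (simp_all add: b.ops linear_add[OF linear_shape[OF x]]
        linear_scale[OF linear_shape[OF x]] algebra_simps)
  ultimately show ?thesis
    by (simp add: tension_def b.metric_trace_orthonormal[OF e] b.trace_orthonormal[OF e linear_shape[OF x]]
        scaleR_sum_left b.sym[of "e _"])
qed

lemma nabla_tension:
  assumes x: "x \<in> U"
  shows "nabla (tension G H F) x v = fderiv \<phi> x v *\<^sub>R \<eta> x + (- \<phi> x) *\<^sub>R fderiv F x (A x v)"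
proof -
  have "nabla (tension G H F) x v = nabla (\<lambda>y. \<phi> y *\<^sub>R \<eta> y) x v"
    by (rule nabla_cong[OF x tension_eq])
  then show ?thesis
    by (simp add: nabla_scaleR[OF x trace_differentiable[OF x] normal_differentiable[OF x]]
        nabla_normal[OF x])
qed

text \<open>Tangential part of the second derivative of \<open>\<phi> y *\<^sub>R \<eta> y\<close>:
  either one derivative falls on \<open>\<phi>\<close> and the other turns \<open>\<eta>\<close>
  into \<open>- A\<close>, in two ways, or both fall on \<open>\<eta>\<close>. In the latter case
  the Christoffel correction of \<open>cov_deriv2\<close> completes the derivative of
  \<open>A\<close> to \<open>nabla_shape\<close>.\<close>

lemma cov_deriv2_tension:
  assumes x: "x \<in> U"
  shows "H (F x) (cov_deriv2 G H F (tension G H F) x u v) (fderiv F x z)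
    = - (fderiv \<phi> x v * G x (A x u) z + fderiv \<phi> x u * G x (A x v) z
        + \<phi> x * G x (nabla_shape x u v) z)"
proof -
  have s1: "smooth_on U (\<lambda>y. fderiv \<phi> y v)"
    by (rule smooth_on_fderiv[OF smooth_trace_shape])
  have s2: "smooth_on U (\<lambda>y. - \<phi> y)"
    by (rule smooth_on_minus[OF src.open_dom smooth_trace_shape])
  have s3: "smooth_on U (\<lambda>y. fderiv F y (A y v))"
    by (rule smooth_on_linear_family[OF src.open_dom linear_dmap smooth_on_fderiv[OF smooth_map]
          smooth_shape])
  note d = s1[THEN smooth_on_differentiable, OF x] s2[THEN smooth_on_differentiable, OF x]
    s3[THEN smooth_on_differentiable, OF x]
  have neg: "fderiv (\<lambda>y. - \<phi> y) x u = - fderiv \<phi> x u"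
    by (rule fderiv_eq[OF has_derivative_minus[OF fderiv_works[OF trace_differentiable[OF x]]]])
  have "nabla (\<lambda>y. nabla (tension G H F) y v) x u
      = nabla (\<lambda>y. fderiv \<phi> y v *\<^sub>R \<eta> y + (- \<phi> y) *\<^sub>R fderiv F y (A y v)) x u"
    by (rule nabla_cong[OF x nabla_tension])
  also have "\<dots> = nabla (\<lambda>y. fderiv \<phi> y v *\<^sub>R \<eta> y) x u + nabla (\<lambda>y. (- \<phi> y) *\<^sub>R fderiv F y (A y v)) x u"
    by (rule nabla_add[OF x]) (intro differentiable_scaleR d normal_differentiable x)+
  also have "\<dots> = fderiv (\<lambda>y. fderiv \<phi> y v) x u *\<^sub>R \<eta> x - fderiv \<phi> x v *\<^sub>R fderiv F x (A x u)
      - fderiv \<phi> x u *\<^sub>R fderiv F x (A x v)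
      - \<phi> x *\<^sub>R (fderiv F x (fderiv (\<lambda>y. A y v) x u + \<Gamma> x u (A x v)) + G x (A x u) (A x v) *\<^sub>R \<eta> x)"
    unfolding nabla_scaleR[OF x d(1) normal_differentiable[OF x]] nabla_scaleR[OF x d(2,3)]
    by (simp add: nabla_normal[OF x] nabla_tangent_field[OF x shape_differentiable[OF x]] neg)
  finally have D: "nabla (\<lambda>y. nabla (tension G H F) y v) x u
      = fderiv (\<lambda>y. fderiv \<phi> y v) x u *\<^sub>R \<eta> x - fderiv \<phi> x v *\<^sub>R fderiv F x (A x u)
      - fderiv \<phi> x u *\<^sub>R fderiv F x (A x v)
      - \<phi> x *\<^sub>R (fderiv F x (fderiv (\<lambda>y. A y v) x u + \<Gamma> x u (A x v)) + G x (A x u) (A x v) *\<^sub>R \<eta> x)" .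
  show ?thesis
    unfolding cov_deriv2_def D
    by (simp add: nabla_tension[OF x] nabla_shape_def tgt_ops[OF x] src.metric_ops[OF x]
        normal[OF x] isometric[OF x, symmetric] algebra_simps)
qed

lemma biconservative_eq:
  assumes x: "x \<in> U"
    and bic: "tangent_part G H F x (bitension G H F x) = 0"
  shows "2 * fderiv \<phi> x (A x z) + \<phi> x * fderiv \<phi> x z = 0"
proof -
  interpret b: inner_form "G x" by (rule src.inner_form_at[OF x])
  obtain e :: "'m \<Rightarrow> real^'m" where e: "\<And>i j. G x (e i) (e j) = (if i = j then 1 else 0)"
    by (rule b.orthonormal_basis_exists) blast
  let ?B = "\<lambda>u v. - (fderiv \<phi> x v * G x (A x u) z + fderiv \<phi> x u * G x (A x v) z
        + \<phi> x * G x (nabla_shape x u v) z)"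
  note lin\<phi> = linear_fderiv[OF trace_differentiable[OF x]]
  have linH: "linear (\<lambda>w. H (F x) w (fderiv F x z))"
    by (rule inner_form.linear_left[OF tgt.inner_form_at[OF maps_to[OF x]]])
  have ns: "linear (nabla_shape x u)" "linear (\<lambda>u. nabla_shape x u v)" for u v
    using bilinear_nabla_shape[OF x] by (auto simp: bilinear_def)
  have bil: "bilinear ?B"
    unfolding bilinear_def
    by (intro conjI allI linearI) (simp_all add: b.ops linear_add[OF linear_shape[OF x]]
        linear_scale[OF linear_shape[OF x]] linear_add[OF lin\<phi>] linear_scale[OF lin\<phi>]
        linear_add[OF ns(1)] linear_scale[OF ns(1)] linear_add[OF ns(2)] linear_scale[OF ns(2)]
        algebra_simps)
  have "linear (\<lambda>w. H (F x) (bitension G H F x) (fderiv F x w))"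
    by (rule linearI) (simp_all add: tgt_ops[OF x] dmap_ops[OF x])
  from b.sharp_works[OF this, of z] bic
  have "0 = H (F x) (bitension G H F x) (fderiv F x z)"
    by (simp add: tangent_part_def b.ops)
  \<comment> \<open>The curvature term of the bitension vanishes here: in constant curvature, the
    tension being normal, \<open>curvature H\<close> yields a multiple of
    \<open>\<eta> x\<close>.\<close>
  also have "\<dots> = metric_trace (G x) ?B - metric_trace (G x) (\<lambda>u v. 0)"
    by (simp add: bitension_def tgt_ops[OF x] linear_metric_trace[OF linH] cov_deriv2_tension[OF x]
        target_curvature_tensor[OF x] tension_eq[OF x] normal[OF x])
  also have "\<dots> = (\<Sum>i\<in>UNIV. ?B (e i) (e i))"
    by (simp only: b.metric_trace_orthonormal[OF e bil]) (simp add: metric_trace_def)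
  \<comment> \<open>The two mixed terms agree on the diagonal, hence the factor 2; self-adjointness
    moves \<open>A x\<close> onto \<open>z\<close>.\<close>
  also have "\<dots> = - 2 * (\<Sum>i\<in>UNIV. G x (A x z) (e i) * fderiv \<phi> x (e i))
      - \<phi> x * (\<Sum>i\<in>UNIV. G x (nabla_shape x (e i) (e i)) z)"
    by (simp add: sum_negf sum.distrib sum_subtractf sum_distrib_left shape_self_adjoint[OF x] b.sym[of "e _"] algebra_simps)
  also have "(\<Sum>i\<in>UNIV. G x (A x z) (e i) * fderiv \<phi> x (e i)) = fderiv \<phi> x (A x z)"
    using arg_cong[OF b.orthonormal_expansion[OF e, of "A x z"], of "fderiv \<phi> x"]
    by (simp add: linear_sum[OF lin\<phi>] linear_scale[OF lin\<phi>])
  finally show ?thesis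
    by (simp add: divergence_shape[OF x e])
qed

text \<open>The Ricci curvature of the source in the direction of the gradient, computed from the Gauss
  equation, is at most \<open>- 3/4 \<phi>\<^sup>2\<close> times the squared length of the gradient.\<close>

lemma trace_shape_times_fderiv:
  assumes x: "x \<in> U" and "c \<le> 0"
    and bic: "tangent_part G H F x (bitension G H F x) = 0"
    and nonneg: "\<And>u v. u \<noteq> v \<Longrightarrow> independent {u, v} \<Longrightarrow> sectional_curvature G x u v \<ge> 0"
  shows "\<phi> x * fderiv \<phi> x z = 0"
proof -
  interpret b: inner_form "G x" by (rule src.inner_form_at[OF x])
  obtain e :: "'m \<Rightarrow> real^'m" where e: "\<And>i j. G x (e i) (e j) = (if i = j then 1 else 0)"
    by (rule b.orthonormal_basis_exists) blast
  define \<xi> where "\<xi> = sharp (G x) (fderiv \<phi> x)"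
  have \<xi>: "G x \<xi> z = fderiv \<phi> x z" for z
    unfolding \<xi>_def by (rule b.sharp_works[OF linear_fderiv[OF trace_differentiable[OF x]]])
  have A\<xi>: "A x \<xi> = (- \<phi> x / 2) *\<^sub>R \<xi>"
  proof (rule b.nondegenerate)
    fix z
    have "fderiv \<phi> x (A x z) = - \<phi> x / 2 * fderiv \<phi> x z"
      using biconservative_eq[OF x bic, of z] by (simp add: field_simps)
    then show "G x (A x \<xi>) z = G x ((- \<phi> x / 2) *\<^sub>R \<xi>) z"
      by (simp add: b.ops shape_self_adjoint[OF x] \<xi>)
  qed
  \<comment> \<open>No basis adapted to \<open>\<xi>\<close> is chosen: an \<open>e i\<close>
    parallel to \<open>\<xi>\<close> only contributes zero.\<close>
  have "0 \<le> (\<Sum>i\<in>UNIV. G x (curvature G x (e i) \<xi> \<xi>) (e i))"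
    by (intro sum_nonneg src.curvature_nonneg[OF x nonneg])
  also have "\<dots> = c * (CARD('m) * G x \<xi> \<xi> - (\<Sum>i\<in>UNIV. G x \<xi> (e i) * G x \<xi> (e i)))
      + G x (A x \<xi>) \<xi> * (\<Sum>i\<in>UNIV. G x (e i) (A x (e i)))
      - (\<Sum>i\<in>UNIV. G x (A x \<xi>) (e i) * G x (A x \<xi>) (e i))"
  proof -
    have "G x (curvature G x (e i) \<xi> \<xi>) (e i) = c * (G x \<xi> \<xi> - G x \<xi> (e i) * G x \<xi> (e i))
      + G x (A x \<xi>) \<xi> * G x (e i) (A x (e i)) - G x (A x \<xi>) (e i) * G x (A x \<xi>) (e i)" for i
      using shape_self_adjoint[OF x, of "e i" \<xi>] b.sym[of "e i" "A x \<xi>"] b.sym[of "e i" \<xi>]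
        b.sym[of "A x (e i)" "e i"]
      by (simp add: gauss_equation[OF x] e)
    then show ?thesis
      by (simp add: sum.distrib sum_subtractf sum_distrib_left[symmetric])
  qed
  \<comment> \<open>Parseval turns the squared coefficients of \<open>\<xi>\<close> into
    \<open>G x \<xi> \<xi>\<close>, which lowers the dimension by one, and those of
    \<open>A x \<xi>\<close> into its squared length.\<close>
  also have "\<dots> = c * (CARD('m) - 1) * G x \<xi> \<xi> + G x (A x \<xi>) \<xi> * \<phi> x - G x (A x \<xi>) (A x \<xi>)"
    unfolding b.parseval[OF e, symmetric] b.trace_orthonormal[OF e linear_shape[OF x]]
    by (simp add: algebra_simps)
  also have "\<dots> = c * (CARD('m) - 1) * G x \<xi> \<xi> - 3 / 4 * ((\<phi> x)\<^sup>2 * G x \<xi> \<xi>)"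
    by (simp add: A\<xi> b.ops power2_eq_square field_simps)
  finally have "3 / 4 * ((\<phi> x)\<^sup>2 * G x \<xi> \<xi>) \<le> c * (CARD('m) - 1) * G x \<xi> \<xi>" by simp
  moreover have p: "G x \<xi> \<xi> \<ge> 0" using b.pos[of \<xi>] by (cases "\<xi> = 0") (auto simp: b.ops)
  moreover have "real CARD('m) - 1 \<ge> 0" by (simp add: Suc_leI)
  ultimately have "(\<phi> x)\<^sup>2 * G x \<xi> \<xi> \<le> 0"
    using mult_nonpos_nonneg[OF mult_nonpos_nonneg[OF \<open>c \<le> 0\<close>] p] by fastforce
  then have "\<phi> x = 0 \<or> \<xi> = 0"
    using p b.pos[of \<xi>] by (metis less_le_not_le mult_pos_pos zero_less_power2)
  then show ?thesis
    using \<xi>[of z] by (auto simp: b.ops)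
qed

end

subsection \<open>Charts\<close>

text \<open>At a zero of \<open>\<phi>\<close> the relation
  \<open>\<phi> x * fderiv \<phi> x z = 0\<close> says nothing about the derivative. But it makes
  \<open>\<phi> y * \<phi> y\<close> constant on a ball; so \<open>\<phi>\<close> is either zero on
  the whole ball, or nonzero on all of it, and then its derivative vanishes there.\<close>

lemma (in hypersurface) trace_shape_locally_constant:
  assumes "c \<le> 0"
    and bic: "\<And>x. x \<in> U \<Longrightarrow> tangent_part G H F x (bitension G H F x) = 0"
    and nonneg: "\<And>x u v. x \<in> U \<Longrightarrow> u \<noteq> v \<Longrightarrow> independent {u, v} \<Longrightarrow> sectional_curvature G x u v \<ge> 0"
    and x: "x \<in> U"
  shows "\<exists>r>0. ball x r \<subseteq> U \<and> (\<forall>y\<in>ball x r. \<phi> y = \<phi> x)"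
proof -
  obtain r where r: "r > 0" "ball x r \<subseteq> U" using src.open_dom x openE by blast
  have flat: "\<phi> y * fderiv \<phi> y z = 0" if "y \<in> U" for y z
    by (rule trace_shape_times_fderiv[OF that \<open>c \<le> 0\<close> bic[OF that] nonneg[OF that]])
  have "((\<lambda>y. \<phi> y * \<phi> y) has_derivative (\<lambda>h. 0)) (at y within ball x r)" if "y \<in> ball x r" for y
  proof -
    have "y \<in> U" using that r by blast
    then have "((\<lambda>y. \<phi> y * \<phi> y) has_derivative (\<lambda>h. 0)) (at y)"
      using has_derivative_mult[OF fderiv_works[OF trace_differentiable[OF \<open>y \<in> U\<close>]]
          fderiv_works[OF trace_differentiable[OF \<open>y \<in> U\<close>]]] flat[of y] by (simp add: mult.commute[of "fderiv _ _ _"])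
    then show ?thesis by (rule has_derivative_at_withinI)
  qed
  then have sq: "\<phi> y * \<phi> y = \<phi> x * \<phi> x" if "y \<in> ball x r" for y
    using has_derivative_zero_unique[of "ball x r" "\<lambda>y. \<phi> y * \<phi> y" x y] that r by auto
  show ?thesis
  proof (cases "\<phi> x = 0")
    case True
    then show ?thesis using r sq by (intro exI[of _ r]) auto
  next
    case False
    have "(\<phi> has_derivative (\<lambda>h. 0)) (at y within ball x r)" if "y \<in> ball x r" for y
    proof -
      have y: "y \<in> U" using that r by blast
      have "\<phi> y \<noteq> 0" using sq[OF that] False by auto
      then have "fderiv \<phi> y = (\<lambda>h. 0)" using flat[OF y] by auto
      then show ?thesis
        using fderiv_works[OF trace_differentiable[OF y]] by (metis has_derivative_at_withinI)
    qed
    then have "\<phi> y = \<phi> x" if "y \<in> ball x r" for y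
      using has_derivative_zero_unique[of "ball x r" \<phi> x y] that r by auto
    then show ?thesis using r by blast
  qed
qed

section \<open>Behaviour of the shape operator under changes of chart\<close>

lemma isometric_map_surj:
  fixes F :: "real^'n \<Rightarrow> real^'n"
  assumes "isometric_map U G V H F" "x \<in> U"
  shows "surj (fderiv F x)"
proof -
  interpret isometric_map U G V H F by fact
  have "inj (fderiv F x)" using inj_dmap[OF assms(2)] by (rule injI)
  then show ?thesis by (intro linear_injective_imp_surjective[OF linear_dmap[OF assms(2)]]) auto
qed

text \<open>Written out, this is the transformation law of the Christoffel symbols.\<close>

lemma nabla_dmap_isometry:
  fixes F :: "real^'n \<Rightarrow> real^'n"
  assumes "isometric_map U G V H F" "x \<in> U"
  shows "cov_deriv H F (\<lambda>y. fderiv F y v) x u = fderiv F x (christoffel G x u v)"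
proof -
  interpret isometric_map U G V H F by fact
  note x = assms(2)
  show ?thesis
  proof (rule tgt.metric_eqI[OF maps_to[OF x]])
    fix w
    obtain z where "w = fderiv F x z" using isometric_map_surj[OF assms] by (metis surjD)
    then show "H (F x) (nabla (\<lambda>y. fderiv F y v) x u) w = H (F x) (fderiv F x (christoffel G x u v)) w"
      by (simp add: nabla_dmap_tangential[OF x] isometric[OF x, symmetric])
  qed
qed

text \<open>\<open>\<kappa>\<close> and \<open>\<sigma>\<close> stand for the transition maps of
  source and target. They are defined only on overlaps, hence the smaller sets \<open>W\<close> and
  \<open>Z\<close>.\<close>

lemma shape_operator_transform:
  fixes \<kappa> :: "real^'m \<Rightarrow> real^'m" and \<sigma> :: "real^'n \<Rightarrow> real^'n"
  assumes h: "hypersurface U G V H F \<eta> c" and h': "hypersurface U' G' V' H' F' \<eta>' c"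
    and iso: "isometric_map W G U' G' \<kappa>" and iso': "isometric_map Z H V' H' \<sigma>"
    and sub: "W \<subseteq> U" "F ` W \<subseteq> Z"
    and F: "\<And>y. y \<in> W \<Longrightarrow> F' (\<kappa> y) = \<sigma> (F y)"
    and n: "\<And>y. y \<in> W \<Longrightarrow> \<eta>' (\<kappa> y) = fderiv \<sigma> (F y) (\<eta> y)"
    and x: "x \<in> W"
  shows "shape_operator G' H' F' \<eta>' (\<kappa> x) (fderiv \<kappa> x u) = fderiv \<kappa> x (shape_operator G H F \<eta> x u)"
proof -
  interpret h: hypersurface U G V H F \<eta> c by fact
  interpret h': hypersurface U' G' V' H' F' \<eta>' c by fact
  interpret k: isometric_map W G U' G' \<kappa> by fact
  interpret s: isometric_map Z H V' H' \<sigma> by fact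
  have xU: "x \<in> U" and Fx: "F x \<in> Z" using x sub by auto
  note kx = k.maps_to[OF x]
  have dF: "fderiv F' (\<kappa> x) (fderiv \<kappa> x z) = fderiv \<sigma> (F x) (fderiv F x z)" for z
  proof -
    have "fderiv (\<lambda>y. F' (\<kappa> y)) x z = fderiv (\<lambda>y. \<sigma> (F y)) x z"
      by (rule fderiv_cong_open[OF k.src.open_dom x F])
    then show ?thesis
      by (simp add: fderiv_compose k.map_differentiable[OF x] h'.map_differentiable[OF kx]
          h.map_differentiable[OF xU] s.map_differentiable[OF Fx])
  qed
  \<comment> \<open>Differentiating the pushed-forward normal produces a second derivative of
    \<open>\<sigma>\<close>, so \<open>\<eta>'\<close> has no tensorial ordinary derivative.\<close>
  have dn: "fderiv \<eta>' (\<kappa> x) (fderiv \<kappa> x u)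
      = fderiv (\<lambda>z. fderiv \<sigma> z (\<eta> x)) (F x) (fderiv F x u) + fderiv \<sigma> (F x) (fderiv \<eta> x u)"
  proof -
    have "fderiv \<eta>' (\<kappa> x) (fderiv \<kappa> x u) = fderiv (\<lambda>y. \<eta>' (\<kappa> y)) x u"
      by (simp add: fderiv_compose k.map_differentiable[OF x] h'.normal_differentiable[OF kx])
    also have "\<dots> = fderiv (\<lambda>y. fderiv \<sigma> (F y) (\<eta> y)) x u"
      by (rule fderiv_cong_open[OF k.src.open_dom x n])
    also have "\<dots> = fderiv (\<lambda>y. fderiv \<sigma> (F y) (\<eta> x)) x u + fderiv \<sigma> (F x) (fderiv \<eta> x u)"
    proof (rule fderiv_linear_family[where L = "\<lambda>y. fderiv \<sigma> (F y)", OF k.src.open_dom x])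
      show "linear (fderiv \<sigma> (F y))" if "y \<in> W" for y
        using s.linear_dmap that sub by auto
      show "(\<lambda>y. fderiv \<sigma> (F y) w) differentiable (at x)" for w
        using differentiable_chain_at[OF h.map_differentiable[OF xU] s.dmap_differentiable[OF Fx]]
        by (simp add: comp_def)
    qed (rule h.normal_differentiable[OF xU])
    also have "fderiv (\<lambda>y. fderiv \<sigma> (F y) (\<eta> x)) x u
        = fderiv (\<lambda>z. fderiv \<sigma> z (\<eta> x)) (F x) (fderiv F x u)"
      by (rule fderiv_compose[OF h.map_differentiable[OF xU] s.dmap_differentiable[OF Fx]])
    finally show ?thesis .
  qed
  \<comment> \<open>The transformation law of the Christoffel symbols absorbs that second
    derivative.\<close>
  have nab: "h'.nabla \<eta>' (\<kappa> x) (fderiv \<kappa> x u) = fderiv \<sigma> (F x) (h.nabla \<eta> x u)"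
    using nabla_dmap_isometry[OF iso' Fx, of "\<eta> x" "fderiv F x u"]
    by (simp add: cov_deriv_def dn dF n[OF x] F[OF x] linear_add[OF s.linear_dmap[OF Fx]])
  show ?thesis
  proof (rule h'.src.metric_eqI[OF kx])
    fix w
    obtain z where w: "w = fderiv \<kappa> x z" using isometric_map_surj[OF iso x] by (metis surjD)
    show "G' (\<kappa> x) (h'.A (\<kappa> x) (fderiv \<kappa> x u)) w = G' (\<kappa> x) (fderiv \<kappa> x (h.A x u)) w"
      by (simp add: w h'.shape_eq[OF kx] nab dF F[OF x] s.isometric[OF Fx, symmetric]
          k.isometric[OF x, symmetric] h.shape_eq[OF xU])
  qed
qed

text \<open>The two shape operators are conjugate under the invertible differential of
  \<open>\<kappa>\<close>.\<close>

lemma trace_shape_transform: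
  fixes \<kappa> :: "real^'m \<Rightarrow> real^'m" and \<sigma> :: "real^'n \<Rightarrow> real^'n"
  assumes h: "hypersurface U G V H F \<eta> c" and h': "hypersurface U' G' V' H' F' \<eta>' c"
    and iso: "isometric_map W G U' G' \<kappa>" and iso': "isometric_map Z H V' H' \<sigma>"
    and sub: "W \<subseteq> U" "F ` W \<subseteq> Z"
    and F: "\<And>y. y \<in> W \<Longrightarrow> F' (\<kappa> y) = \<sigma> (F y)"
    and n: "\<And>y. y \<in> W \<Longrightarrow> \<eta>' (\<kappa> y) = fderiv \<sigma> (F y) (\<eta> y)"
    and x: "x \<in> W"
  shows "trace (matrix (shape_operator G' H' F' \<eta>' (\<kappa> x))) = trace (matrix (shape_operator G H F \<eta> x))"
proof -
  interpret k: isometric_map W G U' G' \<kappa> by fact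
  let ?K = "fderiv \<kappa> x" and ?A = "shape_operator G H F \<eta> x"
    and ?A' = "shape_operator G' H' F' \<eta>' (\<kappa> x)"
  have lin: "linear ?K" by (rule k.linear_dmap[OF x])
  obtain J where J: "linear J" "?K \<circ> J = id"
    using linear_surjective_right_inverse[OF lin isometric_map_surj[OF iso x]] by blast
  then have KJ: "?K (J v) = v" for v by (simp add: fun_eq_iff)
  have JK: "J (?K v) = v" for v
    by (rule k.inj_dmap[OF x]) (simp add: KJ)
  have linA: "linear ?A" using hypersurface.linear_shape[OF h] x sub by auto
  have "?A' = (\<lambda>v. ?K (?A (J v)))"
    using shape_operator_transform[OF assms, of "J _"] by (simp add: KJ fun_eq_iff)
  then have "trace (matrix ?A') = trace (matrix (\<lambda>v. ?K (?A (J v))))" by simp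
  also have "\<dots> = trace (matrix (\<lambda>v. ?A (J (?K v))))"
    using trace_matrix_comm[OF lin linear_compose[OF J(1) linA]] by (simp add: comp_def)
  finally show ?thesis by (simp add: JK)
qed

section \<open>From atlases to local data\<close>

context
  fixes M :: "('a::{t2_space,second_countable_topology}, real^'m) chart set"
    and g :: "('a, real^'m) chart \<Rightarrow> (real^'m) metric"
  assumes M: "oriented_riemannian_manifold M g"
begin

lemma chart_open: "C \<in> M \<Longrightarrow> open (cdom C)"
  and chart_homeomorphism: "C \<in> M \<Longrightarrow> homeomorphism (cdom C) (cmap C ` cdom C) (cmap C) (cinv C)"
  and chart_image_open: "C \<in> M \<Longrightarrow> open (cmap C ` cdom C)"
  using M by (auto simp: oriented_riemannian_manifold_def oriented_manifold_def)

lemma cinv_cmap: "C \<in> M \<Longrightarrow> p \<in> cdom C \<Longrightarrow> cinv C (cmap C p) = p"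
  using homeomorphism_apply1[OF chart_homeomorphism] .

lemma chart_subset_image_open:
  assumes C: "C \<in> M" and S: "open S" "S \<subseteq> cdom C"
  shows "open (cmap C ` S)"
proof -
  have "openin (top_of_set (cdom C)) S" using S by (simp add: open_subset)
  then have "openin (top_of_set (cmap C ` cdom C)) (cmap C ` S)"
    by (rule homeomorphism_imp_open_map[OF chart_homeomorphism[OF C]])
  then show ?thesis using openin_open_trans chart_image_open[OF C] by blast
qed

lemma metric_domain_chart:
  assumes C: "C \<in> M" and S: "open S" "S \<subseteq> cdom C"
  shows "metric_domain (cmap C ` S) (g C)"
proof
  have sub: "cmap C ` S \<subseteq> cmap C ` cdom C" using S by blast
  note def = M[unfolded oriented_riemannian_manifold_def]
  show "open (cmap C ` S)" by (rule chart_subset_image_open[OF assms])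
  show "smooth_on (cmap C ` S) (\<lambda>x. g C x u v)" for u v
    by (rule smooth_on_subset[OF _ sub]) (use def C in blast)
  show "bilinear (g C x)" "g C x u v = g C x v u" "u \<noteq> 0 \<Longrightarrow> g C x u u > 0"
    if "x \<in> cmap C ` S" for x u v
    using def C sub that by blast+
qed

lemma isometric_map_transition:
  assumes C: "C \<in> M" and C': "C' \<in> M" and S: "open S" "S \<subseteq> cdom C \<inter> cdom C'"
  shows "isometric_map (cmap C ` S) (g C) (cmap C' ` cdom C') (g C') (chart_rep C C' id)"
proof -
  have sub: "cmap C ` S \<subseteq> cmap C ` (cdom C \<inter> cdom C')" using S by blast
  note def = M[unfolded oriented_riemannian_manifold_def oriented_manifold_def]
  interpret src: metric_domain "cmap C ` S" "g C"
    using metric_domain_chart[OF C] S by blast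
  interpret tgt: metric_domain "cmap C' ` cdom C'" "g C'"
    using metric_domain_chart[OF C' chart_open[OF C']] by blast
  show ?thesis
  proof
    show "smooth_on (cmap C ` S) (chart_rep C C' id)"
      by (rule smooth_on_subset[OF _ sub]) (use def C C' in blast)
    show "chart_rep C C' id x \<in> cmap C' ` cdom C'" if x: "x \<in> cmap C ` S" for x
    proof -
      obtain p where "p \<in> cdom C" "p \<in> cdom C'" "x = cmap C p" using x S by blast
      then show ?thesis using cinv_cmap[OF C] by (simp add: chart_rep_def)
    qed
    show "g C x u v = g C' (chart_rep C C' id x) (fderiv (chart_rep C C' id) x u)
        (fderiv (chart_rep C C' id) x v)" if "x \<in> cmap C ` S" for x u v
    proof -
      have "x \<in> cmap C ` (cdom C \<inter> cdom C')" using that sub by blast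
      with def C C' show ?thesis by meson
    qed
  qed
qed

end

text \<open>Makes the local theory available for each pair of charts. From here on
  \<open>\<phi>\<close> is the immersion, no longer the trace of the shape operator.\<close>

lemma hypersurface_chart:
  fixes M :: "('a::{t2_space,second_countable_topology}, real^'m) chart set"
    and N :: "('b::{t2_space,second_countable_topology}, real^'n) chart set"
  assumes M: "oriented_riemannian_manifold M g" and N: "oriented_riemannian_manifold N h"
    and K: "constant_sectional_curvature N h c"
    and iso: "isometric_immersion M g N h \<phi>" and eta: "unit_normal_field M N h \<phi> \<eta>"
    and dim: "CARD('n) = CARD('m) + 1"
    and C: "C \<in> M" and D: "D \<in> N"
  defines "S \<equiv> cdom C \<inter> \<phi> -` cdom D"
  shows "open S" and "hypersurface (cmap C ` S) (g C) (cmap D ` cdom D) (h D) (chart_rep C D \<phi>) (\<eta> D \<circ> cinv C) c"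
proof -
  have "continuous_on (cdom C) \<phi>"
    using iso C continuous_on_subset[of "carrier M" \<phi> "cdom C"]
    by (auto simp: isometric_immersion_def smooth_map_def carrier_def)
  then show S: "open S"
    unfolding S_def by (rule continuous_open_preimage[OF _ chart_open[OF M C] chart_open[OF N D]])
  interpret src: metric_domain "cmap C ` S" "g C"
    by (rule metric_domain_chart[OF M C S]) (simp add: S_def)
  interpret tgt: metric_domain "cmap D ` cdom D" "h D"
    by (rule metric_domain_chart[OF N D chart_open[OF N D]]) simp
  note iso = iso[unfolded isometric_immersion_def smooth_map_def, folded S_def]
  have rep: "chart_rep C D \<phi> (cmap C p) = cmap D (\<phi> p)" if "p \<in> S" for p
    using that cinv_cmap[OF M C] by (simp add: chart_rep_def S_def)
  have eta_rep: "(\<eta> D \<circ> cinv C) (cmap C p) = \<eta> D p" if "p \<in> S" for p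
    using that cinv_cmap[OF M C] by (simp add: S_def)
  note eta = eta[unfolded unit_normal_field_def]
  show "hypersurface (cmap C ` S) (g C) (cmap D ` cdom D) (h D) (chart_rep C D \<phi>) (\<eta> D \<circ> cinv C) c"
  proof
    show "smooth_on (cmap C ` S) (chart_rep C D \<phi>)" "smooth_on (cmap C ` S) (\<eta> D \<circ> cinv C)"
      using iso eta C D unfolding S_def by blast+
    show "CARD('n) = CARD('m) + 1" by fact
    fix x assume "x \<in> cmap C ` S"
    then obtain p where p: "p \<in> S" "x = cmap C p" by blast
    show "chart_rep C D \<phi> x \<in> cmap D ` cdom D" using p rep by (auto simp: S_def)
    show "g C x u v = h D (chart_rep C D \<phi> x) (fderiv (chart_rep C D \<phi>) x u)
        (fderiv (chart_rep C D \<phi>) x v)" for u v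
      using iso C D p unfolding S_def by blast
    show "h D (chart_rep C D \<phi> x) ((\<eta> D \<circ> cinv C) x) ((\<eta> D \<circ> cinv C) x) = 1"
      "h D (chart_rep C D \<phi> x) ((\<eta> D \<circ> cinv C) x) (fderiv (chart_rep C D \<phi>) x u) = 0" for u
      using eta C D p rep[of p] eta_rep[of p] unfolding S_def by auto
  next
    show "sectional_curvature (h D) y a b = c"
      if "y \<in> cmap D ` cdom D" "a \<noteq> b" "independent {a, b}" for y a b
      using K D that unfolding constant_sectional_curvature_def by blast
  qed
qed

text \<open>Needed because \<open>mean_curvature\<close> selects its charts point by point, while
  local constancy is proved in one fixed pair.\<close>

lemma trace_shape_chart_independent:
  fixes M :: "('a::{t2_space,second_countable_topology}, real^'m) chart set"
    and N :: "('b::{t2_space,second_countable_topology}, real^'n) chart set"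
  assumes M: "oriented_riemannian_manifold M g" and N: "oriented_riemannian_manifold N h"
    and K: "constant_sectional_curvature N h c"
    and iso: "isometric_immersion M g N h \<phi>" and eta: "unit_normal_field M N h \<phi> \<eta>"
    and dim: "CARD('n) = CARD('m) + 1"
    and C: "C \<in> M" "C' \<in> M" and D: "D \<in> N" "D' \<in> N"
    and p: "p \<in> cdom C" "p \<in> cdom C'" "\<phi> p \<in> cdom D" "\<phi> p \<in> cdom D'"
  shows "trace (matrix (shape_operator (g C') (h D') (chart_rep C' D' \<phi>) (\<eta> D' \<circ> cinv C') (cmap C' p)))
    = trace (matrix (shape_operator (g C) (h D) (chart_rep C D \<phi>) (\<eta> D \<circ> cinv C) (cmap C p)))"
proof -
  define S where "S = (cdom C \<inter> \<phi> -` cdom D) \<inter> (cdom C' \<inter> \<phi> -` cdom D')"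
  define Z where "Z = cdom D \<inter> cdom D'"
  note hyp = hypersurface_chart[OF M N K iso eta dim]
  have S: "open S" "S \<subseteq> cdom C \<inter> cdom C'" and Z: "open Z" "Z \<subseteq> cdom D \<inter> cdom D'" and pS: "p \<in> S"
    using hyp(1)[OF C(1) D(1)] hyp(1)[OF C(2) D(2)] chart_open[OF N D(1)] chart_open[OF N D(2)] p
    by (auto simp: S_def Z_def)
  have inv: "cinv C (cmap C q) = q" "cinv C' (cmap C' q) = q" "cinv D (cmap D (\<phi> q)) = \<phi> q"
    if "q \<in> S" for q
    using that cinv_cmap[OF M] cinv_cmap[OF N] C D by (auto simp: S_def)
  have "trace (matrix (shape_operator (g C') (h D') (chart_rep C' D' \<phi>) (\<eta> D' \<circ> cinv C')
      (chart_rep C C' id (cmap C p))))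
    = trace (matrix (shape_operator (g C) (h D) (chart_rep C D \<phi>) (\<eta> D \<circ> cinv C) (cmap C p)))"
  proof (rule trace_shape_transform[OF hyp(2)[OF C(1) D(1)] hyp(2)[OF C(2) D(2)]])
    show "isometric_map (cmap C ` S) (g C) (cmap C' ` (cdom C' \<inter> \<phi> -` cdom D')) (g C') (chart_rep C C' id)"
    proof -
      interpret i: isometric_map "cmap C ` S" "g C" "cmap C' ` cdom C'" "g C'" "chart_rep C C' id"
        by (rule isometric_map_transition[OF M C S])
      \<comment> \<open>The transition map is known as an isometric map into the whole image of
        \<open>C'\<close>; on \<open>S\<close> its values lie in the part over \<open>D'\<close>,
        where the second local hypersurface lives.\<close>
      interpret t: metric_domain "cmap C' ` (cdom C' \<inter> \<phi> -` cdom D')" "g C'"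
        by (rule metric_domain_chart[OF M C(2) hyp(1)[OF C(2) D(2)]]) simp
      show ?thesis
        using i.smooth_map i.isometric inv by unfold_locales (auto simp: chart_rep_def S_def)
    qed
    show "isometric_map (cmap D ` Z) (h D) (cmap D' ` cdom D') (h D') (chart_rep D D' id)"
      by (rule isometric_map_transition[OF N D Z])
    show "cmap C ` S \<subseteq> cmap C ` (cdom C \<inter> \<phi> -` cdom D)" by (auto simp: S_def)
    show "chart_rep C D \<phi> ` cmap C ` S \<subseteq> cmap D ` Z"
      using inv by (auto simp: chart_rep_def S_def Z_def)
    show "cmap C p \<in> cmap C ` S" using pS by blast
    fix y assume "y \<in> cmap C ` S"
    then obtain q where q: "q \<in> S" "y = cmap C q" by blast
    show "chart_rep C' D' \<phi> (chart_rep C C' id y) = chart_rep D D' id (chart_rep C D \<phi> y)"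
      using inv q by (simp add: chart_rep_def)
    show "(\<eta> D' \<circ> cinv C') (chart_rep C C' id y)
        = fderiv (chart_rep D D' id) (chart_rep C D \<phi> y) ((\<eta> D \<circ> cinv C) y)"
    proof -
      have "\<eta> D' q = fderiv (chart_rep D D' id) (cmap D (\<phi> q)) (\<eta> D q)"
        using eta D q C unfolding unit_normal_field_def carrier_def S_def by blast
      then show ?thesis
        using inv[OF q(1)] q by (simp add: chart_rep_def[of C])
    qed
  qed
  then show ?thesis using inv[OF pS] by (simp add: chart_rep_def[of C C'])
qed

theorem proposition2p5:
  fixes M :: "('a::{t2_space,second_countable_topology}, real^'m) chart set"
    and g :: "('a, real^'m) chart \<Rightarrow> (real^'m) metric"
    and N :: "('b::{t2_space,second_countable_topology}, real^'n) chart set"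
    and h :: "('b, real^'n) chart \<Rightarrow> (real^'n) metric"
    and c :: real
    and \<phi> :: "'a \<Rightarrow> 'b"
    and \<eta> :: "('b, real^'n) chart \<Rightarrow> 'a \<Rightarrow> real^'n"
  assumes "CARD('m) \<ge> 2" and "CARD('n) = CARD('m) + 1"
    and "oriented_riemannian_manifold M g"
    and "space_form N h c" and "c \<le> 0"
    and "isometric_immersion M g N h \<phi>"
    and "unit_normal_field M N h \<phi> \<eta>"
    and "biconservative M g N h \<phi>"
    and "nonneg_sectional_curvature M g"
  shows "mean_curvature M g N h \<phi> \<eta> constant_on carrier M"
proof (rule locally_constant_imp_constant)
  note M = assms(3)
  have N: "oriented_riemannian_manifold N h" and K: "constant_sectional_curvature N h c"
    using assms(4) by (auto simp: space_form_def)
  note local = M N K assms(6,7,2)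
  show "connected (carrier M)"
    using M by (simp add: oriented_riemannian_manifold_def oriented_manifold_def)
  have charts: "chart_at B q \<in> B \<and> q \<in> cdom (chart_at B q)" if "q \<in> carrier B"
    for B :: "('x, 'y) chart set" and q
    unfolding chart_at_def by (rule someI_ex) (use that in \<open>auto simp: carrier_def\<close>)
  have maps: "\<phi> q \<in> carrier N" if "q \<in> carrier M" for q
    using assms(6) that by (auto simp: isometric_immersion_def smooth_map_def)
  fix p assume p: "p \<in> carrier M"
  define C where "C = chart_at M p"
  define D where "D = chart_at N (\<phi> p)"
  have C: "C \<in> M" "p \<in> cdom C" and D: "D \<in> N" "\<phi> p \<in> cdom D"
    using charts[OF p] charts[OF maps[OF p]] by (auto simp: C_def D_def)
  define S where "S = cdom C \<inter> \<phi> -` cdom D"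
  define f where "f x = trace (matrix (shape_operator (g C) (h D) (chart_rep C D \<phi>) (\<eta> D \<circ> cinv C) x))" for x
  interpret hs: hypersurface "cmap C ` S" "g C" "cmap D ` cdom D" "h D" "chart_rep C D \<phi>" "\<eta> D \<circ> cinv C" c
    unfolding S_def by (rule hypersurface_chart(2)[OF local C(1) D(1)])
  \<comment> \<open>Replaces the charts selected at \<open>q\<close> by the pair \<open>C\<close>,
    \<open>D\<close> selected at \<open>p\<close>, for all \<open>q\<close> near \<open>p\<close> at
    once.\<close>
  have mean: "mean_curvature M g N h \<phi> \<eta> q = f (cmap C q) / real CARD('m)" if "q \<in> S" for q
  proof -
    have q: "q \<in> carrier M" using that C by (auto simp: S_def carrier_def)
    show ?thesis
      using trace_shape_chart_independent[OF local C(1) _ D(1), of "chart_at M q" "chart_at N (\<phi> q)" q]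
        charts[OF q] charts[OF maps[OF q]] that
      by (simp add: mean_curvature_def Let_def f_def S_def)
  qed
  have pS: "p \<in> S" using C D by (simp add: S_def)
  have "\<exists>r>0. ball (cmap C p) r \<subseteq> cmap C ` S \<and> (\<forall>y\<in>ball (cmap C p) r. f y = f (cmap C p))"
    unfolding f_def
  proof (rule hs.trace_shape_locally_constant[OF assms(5)])
    fix x assume "x \<in> cmap C ` S"
    then have x: "x \<in> cmap C ` (cdom C \<inter> \<phi> -` cdom D)" by (simp add: S_def)
    then show "tangent_part (g C) (h D) (chart_rep C D \<phi>) x (bitension (g C) (h D) (chart_rep C D \<phi>) x) = 0"
      using assms(8) C D unfolding biconservative_def by blast
    show "sectional_curvature (g C) x u v \<ge> 0" if "u \<noteq> v" "independent {u, v}" for u v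
      using assms(9) C x that unfolding nonneg_sectional_curvature_def by blast
  qed (use pS in blast)
  then obtain r where r: "r > 0" "ball (cmap C p) r \<subseteq> cmap C ` S"
    "\<And>y. y \<in> ball (cmap C p) r \<Longrightarrow> f y = f (cmap C p)" by blast
  \<comment> \<open>The coordinate ball pulled back to the manifold, a neighbourhood of
    \<open>p\<close> on which the mean curvature is constant.\<close>
  define T where "T = S \<inter> cmap C -` ball (cmap C p) r"
  have "open S" unfolding S_def by (rule hypersurface_chart(1)[OF local C(1) D(1)])
  moreover have "continuous_on S (cmap C)"
    using chart_homeomorphism[OF M C(1)] continuous_on_subset[of "cdom C" "cmap C" S]
    by (auto simp: homeomorphism_def S_def)
  ultimately have "open T"
    unfolding T_def by (intro continuous_open_preimage) auto
  moreover have "T \<subseteq> carrier M" using C by (auto simp: T_def S_def carrier_def)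
  moreover have "mean_curvature M g N h \<phi> \<eta> q = mean_curvature M g N h \<phi> \<eta> p" if "q \<in> T" for q
    using that r(3) mean pS by (simp add: T_def)
  moreover have "p \<in> T" using pS r(1) by (simp add: T_def)
  ultimately show "\<exists>T. openin (top_of_set (carrier M)) T \<and> p \<in> T
      \<and> (\<forall>q\<in>T. mean_curvature M g N h \<phi> \<eta> q = mean_curvature M g N h \<phi> \<eta> p)"
    by (intro exI[of _ T] conjI ballI open_subset)
qed

end
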